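(* Let $b<\infty$, let $0\neq g\in\mathbf{SOC}(-\infty,b)$ be non-constant, and let $A,B$ be self-adjoint operators on a complex Hilbert space with spectra in $(-\infty,b)$. Then: (i) If $A>B$, then $g(A)>g(B)$. (ii) If $A-B\geq m>0$ for some scalar $m>0$, then $$g(A)-g(B)\geq g(\tau_{A})-g(\tau_{A}-m)\geq g(\tau_{B}+m)-g(\tau_{B})>0,$$ where $\tau_{A}=\min\mathrm{sp}(A)$ and $\tau_{B}=\min\mathrm{sp}(B)$.
   Context: Operators are bounded linear operators on a complex Hilbert space $\mathcal{H}$ (nonzero, otherwise arbitrary). $\mathrm{sp}(A)$ is the spectrum of $A$. $A\ge 0$ (positive) means $\langle Ax,x\rangle\ge 0$ for all $x\in\mathcal{H}$; $A>0$ means $A$ is positive and invertible; for self-adjoint $A,B$, $A\ge B$ means $A-B\ge 0$ and $A>B$ means $A-B>0$; a scalar $m$ in an operator inequality stands for $mI$. $g(A)$ denotes the continuous functional calculus. A continuous real-valued function $g$ on an interval $J$ is strongly operator convex on $J$, written $g\in\mathbf{SOC}(J)$, if $P g(PAP)P\le g(A)$ for every self-adjoint operator $A$ (on any complex Hilbert space) with spectrum in $J$ and every orthogonal projection $P$; here $g(PAP)$ is computed for the compression of $A$ to the range of $P$, so $Pg(PAP)P$ equals $g(PAP|_{P\mathcal{H}})$ on $P\mathcal{H}$ and $0$ on $(P\mathcal{H})^\perp$. *)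

theory Defs
  imports "HOL-Analysis.Analysis" "HOL-Computational_Algebra.Polynomial" "HOL-Library.Nonpos_Ints"
begin

text \<open>
  Complex Hilbert spaces, as a refinement of the real Hilbert spaces of the library: the real
  inner product is the real part of the complex one, which is linear in its first argument.
  Positive definiteness and the formula for the norm are inherited from \<^class>\<open>real_inner\<close>,
  completeness from \<^class>\<open>banach\<close>.
\<close>

class complex_hilbert = real_inner + banach +
  fixes scaleC :: "complex \<Rightarrow> 'a \<Rightarrow> 'a"
    and cinner :: "'a \<Rightarrow> 'a \<Rightarrow> complex"
  assumes scaleC_add_right: "scaleC c (x + y) = scaleC c x + scaleC c y"
    and scaleC_add_left: "scaleC (c + d) x = scaleC c x + scaleC d x"
    and scaleC_scaleC: "scaleC c (scaleC d x) = scaleC (c * d) x"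
    and scaleC_of_real: "scaleC (complex_of_real r) x = scaleR r x"
    and cinner_commute: "cinner x y = cnj (cinner y x)"
    and cinner_add_left: "cinner (x + y) z = cinner x z + cinner y z"
    and cinner_scaleC_left: "cinner (scaleC c x) y = c * cinner x y"
    and Re_cinner: "Re (cinner x y) = inner x y"

instantiation complex :: complex_hilbert
begin

definition scaleC_complex :: "complex \<Rightarrow> complex \<Rightarrow> complex" where
  "scaleC_complex c x = c * x"

definition cinner_complex :: "complex \<Rightarrow> complex \<Rightarrow> complex" where
  "cinner_complex x y = x * cnj y"

instance
  by standard (auto simp: scaleC_complex_def cinner_complex_def inner_complex_def
      algebra_simps scaleR_conv_of_real)

end

lemma norm_scaleC: "norm (scaleC c (x :: 'h::complex_hilbert)) = cmod c * norm x"
proof -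
  have im: "Im (cinner x x) = 0"
    using arg_cong[OF cinner_commute[of x x], of Im] by simp
  have "cinner (scaleC c x) (scaleC c x) = c * cnj (cinner (scaleC c x) x)"
    using cinner_commute[of x "scaleC c x"] by (simp add: cinner_scaleC_left)
  also have "\<dots> = (c * cnj c) * cinner x x"
    using cinner_commute[of x x] by (simp add: cinner_scaleC_left)
  finally have "inner (scaleC c x) (scaleC c x) = (cmod c)\<^sup>2 * inner x x"
    using im by (simp add: Re_cinner[symmetric] complex_mult_cnj cmod_power2)
  then show ?thesis
    by (simp add: norm_eq_sqrt_inner real_sqrt_mult)
qed

text \<open>
  Operators are bounded operators in the sense of the library (hence real linear) which are in
  addition complex linear.
\<close>

lift_definition scalar_op :: "complex \<Rightarrow> 'h::complex_hilbert \<Rightarrow>\<^sub>L 'h" is scaleC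
proof
  fix c d :: complex and r :: real and x y :: 'h
  show "scaleC c (x + y) = scaleC c x + scaleC c y"
    by (rule scaleC_add_right)
  show "scaleC c (r *\<^sub>R x) = r *\<^sub>R scaleC c x"
    by (simp add: scaleC_of_real[symmetric] scaleC_scaleC mult.commute)
  show "\<exists>K. \<forall>x::'h. norm (scaleC c x) \<le> norm x * K"
    by (auto simp: norm_scaleC mult.commute intro!: exI[of _ "cmod c"])
qed

definition clinear_op :: "('h::complex_hilbert \<Rightarrow>\<^sub>L 'h) \<Rightarrow> bool" where
  "clinear_op T \<longleftrightarrow> (\<forall>c x. T (scaleC c x) = scaleC c (T x))"

definition selfadjoint :: "('h::complex_hilbert \<Rightarrow>\<^sub>L 'h) \<Rightarrow> bool" where
  "selfadjoint T \<longleftrightarrow> clinear_op T \<and> (\<forall>x y. cinner (T x) y = cinner x (T y))"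

definition orth_projection :: "('h::complex_hilbert \<Rightarrow>\<^sub>L 'h) \<Rightarrow> bool" where
  "orth_projection P \<longleftrightarrow> selfadjoint P \<and> P o\<^sub>L P = P"

definition positive_op :: "('h::complex_hilbert \<Rightarrow>\<^sub>L 'h) \<Rightarrow> bool" where
  "positive_op T \<longleftrightarrow> (\<forall>x. cinner (T x) x \<in> \<real>\<^sub>\<ge>\<^sub>0)"

definition op_le :: "('h::complex_hilbert \<Rightarrow>\<^sub>L 'h) \<Rightarrow> ('h \<Rightarrow>\<^sub>L 'h) \<Rightarrow> bool" where
  "op_le S T \<longleftrightarrow> positive_op (T - S)"

text \<open>
  The range of an orthogonal projection \<open>P\<close> is a Hilbert space with identity \<open>P\<close>. Its operators
  are represented by their extension by \<open>0\<close> to the orthogonal complement, i.e. by the operators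
  \<open>T\<close> with \<open>PTP = T\<close>; sums, products, adjoints, norms and positivity are then those of the ambient
  space, but invertibility, the spectrum and the constant term of a polynomial in \<open>T\<close> refer to the
  identity \<open>P\<close>. The ambient space itself is the case \<open>P = id_blinfun\<close>.
\<close>

definition op_on :: "('h::complex_hilbert \<Rightarrow>\<^sub>L 'h) \<Rightarrow> ('h \<Rightarrow>\<^sub>L 'h) \<Rightarrow> bool" where
  "op_on P T \<longleftrightarrow> clinear_op T \<and> P o\<^sub>L T o\<^sub>L P = T"

definition invertible_on :: "('h::complex_hilbert \<Rightarrow>\<^sub>L 'h) \<Rightarrow> ('h \<Rightarrow>\<^sub>L 'h) \<Rightarrow> bool" where
  "invertible_on P T \<longleftrightarrow> (\<exists>R. op_on P R \<and> R o\<^sub>L T = P \<and> T o\<^sub>L R = P)"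

definition spectrum_on :: "('h::complex_hilbert \<Rightarrow>\<^sub>L 'h) \<Rightarrow> ('h \<Rightarrow>\<^sub>L 'h) \<Rightarrow> complex set" where
  "spectrum_on P T = {z. \<not> invertible_on P (T - (scalar_op z o\<^sub>L P))}"

primrec pow_on :: "('h::complex_hilbert \<Rightarrow>\<^sub>L 'h) \<Rightarrow> ('h \<Rightarrow>\<^sub>L 'h) \<Rightarrow> nat \<Rightarrow> ('h \<Rightarrow>\<^sub>L 'h)" where
  "pow_on P T 0 = P"
| "pow_on P T (Suc n) = T o\<^sub>L pow_on P T n"

definition poly_on ::
  "('h::complex_hilbert \<Rightarrow>\<^sub>L 'h) \<Rightarrow> real poly \<Rightarrow> ('h \<Rightarrow>\<^sub>L 'h) \<Rightarrow> ('h \<Rightarrow>\<^sub>L 'h)" where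
  "poly_on P p T = (\<Sum>i\<le>degree p. coeff p i *\<^sub>R pow_on P T i)"

text \<open>
  Continuous functional calculus of a self-adjoint operator \<open>T\<close> on the range of \<open>P\<close>, for a real
  function \<open>g\<close> that is continuous on the spectrum: \<open>g(T)\<close> is the norm limit of \<open>p\<^sub>n(T)\<close> for all
  polynomials \<open>p\<^sub>n\<close> converging to \<open>g\<close> uniformly on the spectrum. It is again represented by
  its extension by \<open>0\<close>.
\<close>

definition cfc_on ::
  "('h::complex_hilbert \<Rightarrow>\<^sub>L 'h) \<Rightarrow> (real \<Rightarrow> real) \<Rightarrow> ('h \<Rightarrow>\<^sub>L 'h) \<Rightarrow> ('h \<Rightarrow>\<^sub>L 'h)" where
  "cfc_on P g T = (THE L. \<forall>p :: nat \<Rightarrow> real poly.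
     uniform_limit {t. complex_of_real t \<in> spectrum_on P T} (\<lambda>n. poly (p n)) g sequentially
       \<longrightarrow> (\<lambda>n. poly_on P (p n) T) \<longlonglongrightarrow> L)"

abbreviation invertible_op :: "('h::complex_hilbert \<Rightarrow>\<^sub>L 'h) \<Rightarrow> bool" where
  "invertible_op \<equiv> invertible_on id_blinfun"

abbreviation spectrum :: "('h::complex_hilbert \<Rightarrow>\<^sub>L 'h) \<Rightarrow> complex set" where
  "spectrum \<equiv> spectrum_on id_blinfun"

abbreviation cfc :: "(real \<Rightarrow> real) \<Rightarrow> ('h::complex_hilbert \<Rightarrow>\<^sub>L 'h) \<Rightarrow> ('h \<Rightarrow>\<^sub>L 'h)" where
  "cfc \<equiv> cfc_on id_blinfun"

definition op_less :: "('h::complex_hilbert \<Rightarrow>\<^sub>L 'h) \<Rightarrow> ('h \<Rightarrow>\<^sub>L 'h) \<Rightarrow> bool" where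
  "op_less S T \<longleftrightarrow> positive_op (T - S) \<and> invertible_op (T - S)"

definition min_sp :: "('h::complex_hilbert \<Rightarrow>\<^sub>L 'h) \<Rightarrow> real" where
  "min_sp T = (LEAST t. complex_of_real t \<in> spectrum T)"

text \<open>
  Strong operator convexity on \<open>J\<close>. A definition in HOL cannot quantify over all types, so
  "all complex Hilbert spaces" are taken within a universe, the type \<open>'u\<close>: they are the closed
  subspaces of \<open>'u\<close>, given as the ranges of the projections \<open>Q\<close>. Up to unitary equivalence these
  are all Hilbert spaces of dimension at most that of \<open>'u\<close>; the notion is meant for
  infinite-dimensional (but otherwise arbitrary, e.g. arbitrarily large) \<open>'u\<close>. \<open>A\<close> is an operator
  on the range of \<open>Q\<close>, and \<open>PQ = P\<close> says that the range of \<open>P\<close> is contained in that of \<open>Q\<close>.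
  Since \<open>cfc_on P\<close> already yields the extension by \<open>0\<close>, it is the operator \<open>P g(PAP) P\<close>.
\<close>

definition SOC :: "'u::complex_hilbert itself \<Rightarrow> real set \<Rightarrow> (real \<Rightarrow> real) set" where
  "SOC _ J = {g. continuous_on J g \<and>
     (\<forall>Q A P :: 'u \<Rightarrow>\<^sub>L 'u.
        orth_projection Q \<and> op_on Q A \<and> selfadjoint A \<and> spectrum_on Q A \<subseteq> complex_of_real ` J \<and>
        orth_projection P \<and> P o\<^sub>L Q = P
        \<longrightarrow> op_le (cfc_on P g (P o\<^sub>L A o\<^sub>L P)) (cfc_on Q g A))}"

end

theory Submission
  imports Defs "HOL-Computational_Algebra.Fundamental_Theorem_Algebra"
begin

text \<open>
  A function \<open>g\<close> that is strongly operator convex on \<open>(-\<infinity>, b)\<close> is operator monotone, and the whole theorem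
  rests on this. Let \<open>B \<le> A\<close> and \<open>0 < t < 1\<close>, and write \<open>B = t A + (1 - t) D\<close>. Then
  \<open>D = A - (A - B) / (1 - t) \<le> A\<close>, so the spectrum of \<open>D\<close> lies in \<open>(-\<infinity>, b)\<close> as well; only an interval
  that is unbounded below permits this choice. The compression inequality for \<open>A \<oplus> D\<close> and the range of the
  isometry \<open>v \<mapsto> (\<surd>t v, \<surd>(1 - t) v)\<close> has \<open>t g(B) \<le> g(A)\<close> as its upper left corner
  (\<open>SOC_two_block\<close>, \<open>SOC_monotone_finite_rank\<close>), and \<open>t \<rightarrow> 1\<close> gives \<open>g(B) \<le> g(A)\<close>.
  
  Strong operator convexity is given in a space \<open>'u\<close> that may be smaller or larger than the space of
  \<open>A\<close> and \<open>B\<close>. The argument is therefore carried out on finite-dimensional subspaces, two orthogonal copies of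
  which fit into any infinite-dimensional space. The general case follows by approximating \<open>g\<close> by a polynomial \<open>p\<close>, since for a fixed
  vector \<open>x\<close> the vectors \<open>p(A)x\<close> and \<open>p(B)x\<close> only involve finitely many vectors (\<open>SOC_operator_monotone\<close>).
  
  The rest concerns the scalar function. The same two-block inequality shows that \<open>g\<close> is convex, and operator
  monotonicity for matrices of size two excludes that \<open>g\<close> is constant on a half-line and increases later; a
  nonconstant \<open>g\<close> is therefore strictly increasing (\<open>SOC_strict_mono_on\<close>). If \<open>A - B \<ge> m > 0\<close>, then
  \<open>g(A) - g(B) \<ge> g(A) - g(A - m) = \<phi>(A)\<close> for the nondecreasing function \<open>\<phi> t = g t - g (t - m)\<close>, which leads to
  the scalar bounds (\<open>SOC_gap\<close>). If \<open>A > B\<close>, such an \<open>m\<close> exists.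
  
  The functional calculus is accessed through two facts: the norm of \<open>p(T)\<close> is the value of \<open>\<bar>p\<bar>\<close> at some point of the
  spectrum (\<open>norm_poly_on_attained\<close>), and the least and the greatest point of the spectrum are the optimal
  bounds of the quadratic form (\<open>spectrum_on_between\<close>, \<open>spectrum_on_extreme\<close>).
\<close>

section \<open>Complex inner products\<close>

lemma cinner_add_right: "cinner x (y + z) = cinner x y + cinner (x::'h::complex_hilbert) z"
  using cinner_commute[of x "y+z"] cinner_commute[of x y] cinner_commute[of x z]
  by (simp add: cinner_add_left)

lemma cinner_scaleC_right: "cinner x (scaleC c y) = cnj c * cinner (x::'h::complex_hilbert) y"
  using cinner_commute[of x "scaleC c y"] cinner_commute[of x y]
  by (simp add: cinner_scaleC_left)

lemma cinner_scaleR_left: "cinner (r *\<^sub>R x) y = r * cinner (x::'h::complex_hilbert) y"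
  by (metis cinner_scaleC_left scaleC_of_real)

lemma cinner_scaleR_right: "cinner x (r *\<^sub>R y) = r * cinner (x::'h::complex_hilbert) y"
  by (metis cinner_scaleC_right complex_cnj_complex_of_real scaleC_of_real)

lemma cinner_zero_left [simp]: "cinner 0 (y::'h::complex_hilbert) = 0"
  using cinner_scaleR_left[of 0 0 y] by simp

lemma cinner_zero_right [simp]: "cinner (y::'h::complex_hilbert) 0 = 0"
  using cinner_scaleR_right[of y 0 0] by simp

lemma cinner_minus_left: "cinner (- x) y = - cinner (x::'h::complex_hilbert) y"
  using cinner_scaleR_left[of "-1" x y] by simp

lemma cinner_minus_right: "cinner x (- y) = - cinner (x::'h::complex_hilbert) y"
  using cinner_scaleR_right[of x "-1" y] by simp

lemma cinner_diff_left: "cinner (x - y) z = cinner x z - cinner (y::'h::complex_hilbert) z"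
  using cinner_add_left[of x "-y" z] by (simp add: cinner_minus_left)

lemma cinner_diff_right: "cinner x (y - z) = cinner x y - cinner (x::'h::complex_hilbert) z"
  using cinner_add_right[of x y "-z"] by (simp add: cinner_minus_right)

lemma cinner_sum_left: "cinner (sum f I) y = (\<Sum>i\<in>I. cinner (f i) (y::'h::complex_hilbert))"
  by (induction I rule: infinite_finite_induct) (simp_all add: cinner_add_left)

lemma Im_cinner: "Im (cinner x y) = inner (x::'h::complex_hilbert) (scaleC \<i> y)"
  by (simp add: Re_cinner[symmetric] cinner_scaleC_right)

lemma cinner_self: "cinner x x = complex_of_real ((norm (x::'h::complex_hilbert))\<^sup>2)"
proof (rule complex_eqI)
  show "Im (cinner x x) = Im (complex_of_real ((norm x)\<^sup>2))"
    using arg_cong[OF cinner_commute[of x x], of Im] by simp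
qed (simp add: Re_cinner dot_square_norm)

lemma cinner_ext: "(\<And>z. cinner x z = cinner y z) \<Longrightarrow> x = (y::'h::complex_hilbert)"
  using cinner_self[of "x - y"] by (simp add: cinner_diff_left)

text \<open>
  A crude constant suffices for the continuity of the inner product, and it follows from the real
  Cauchy-Schwarz inequality applied to the real and the imaginary part.
\<close>

lemma cmod_cinner_le: "cmod (cinner x y) \<le> 2 * (norm x * norm (y::'h::complex_hilbert))"
proof -
  have "\<bar>Re (cinner x y)\<bar> \<le> norm x * norm y" "\<bar>Im (cinner x y)\<bar> \<le> norm x * norm y"
    using Cauchy_Schwarz_ineq2[of x y] Cauchy_Schwarz_ineq2[of x "scaleC \<i> y"]
    by (simp_all add: Re_cinner Im_cinner norm_scaleC)
  then show ?thesis
    using cmod_le[of "cinner x y"] by linarith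
qed

lemma tendsto_cinner:
  assumes "(f \<longlongrightarrow> x) F" "(g \<longlongrightarrow> y) F"
  shows "((\<lambda>n. cinner (f n) (g n :: 'h::complex_hilbert)) \<longlongrightarrow> cinner x y) F"
proof -
  have "bounded_linear (scaleC \<i> :: 'h \<Rightarrow> 'h)"
    by (metis blinfun.bounded_linear_right scalar_op.rep_eq)
  then have "((\<lambda>n. scaleC \<i> (g n)) \<longlongrightarrow> scaleC \<i> y) F"
    by (rule bounded_linear.tendsto[OF _ assms(2)])
  then show ?thesis
    using assms by (auto simp: tendsto_complex_iff Re_cinner Im_cinner intro!: tendsto_intros)
qed

lemma scaleC_1 [simp]: "scaleC 1 (x::'h::complex_hilbert) = x"
  using scaleC_of_real[of 1 x] by simp

lemma scaleC_0 [simp]: "scaleC 0 (x::'h::complex_hilbert) = 0"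
  using scaleC_of_real[of 0 x] by simp

lemma scaleC_0_right [simp]: "scaleC c (0::'h::complex_hilbert) = 0"
  using norm_scaleC[of c "0::'h"] by simp

lemma scaleC_minus_left: "scaleC (- c) (x::'h::complex_hilbert) = - scaleC c x"
  using scaleC_add_left[of c "-c" x] by (simp add: eq_neg_iff_add_eq_0 add.commute)

lemma scaleC_diff_right: "scaleC c (x - y) = scaleC c (x::'h::complex_hilbert) - scaleC c y"
  using scaleC_add_right[of c "x - y" y] by (simp add: algebra_simps)

lemma scaleC_sum_right: "scaleC c (sum f I) = (\<Sum>i\<in>I. scaleC c (f i :: 'h::complex_hilbert))"
  by (induction I rule: infinite_finite_induct) (simp_all add: scaleC_add_right)

lemma scaleR_scaleC: "scaleR r (scaleC c x) = scaleC (r * c) (x::'h::complex_hilbert)"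
  by (simp add: scaleC_of_real[symmetric] scaleC_scaleC)

section \<open>Adjoints and self-adjoint operators\<close>

text \<open>
  Adjoints are handled as a relation between two given operators, possibly between different spaces.
  An operator with an adjoint is automatically complex linear, so that adjointness is the only
  algebraic property to be checked in constructions.
\<close>

definition is_adjoint ::
  "('h::complex_hilbert \<Rightarrow>\<^sub>L 'k::complex_hilbert) \<Rightarrow> ('k \<Rightarrow>\<^sub>L 'h) \<Rightarrow> bool" where
  "is_adjoint J K \<longleftrightarrow> (\<forall>x y. cinner (J x) y = cinner x (K y))"

lemma is_adjointD: "is_adjoint J K \<Longrightarrow> cinner (J x) y = cinner x (K y)"
  by (simp add: is_adjoint_def)

lemma is_adjoint_scaleC:
  assumes "is_adjoint J K" shows "J (scaleC c x) = scaleC c (J x)"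
  by (rule cinner_ext) (simp add: is_adjointD[OF assms] cinner_scaleC_left)

lemma is_adjoint_sym: "is_adjoint J K \<Longrightarrow> is_adjoint K J"
  unfolding is_adjoint_def by (metis cinner_commute)

lemma selfadjoint_iff: "selfadjoint T \<longleftrightarrow> is_adjoint T T"
  using is_adjoint_scaleC unfolding selfadjoint_def clinear_op_def is_adjoint_def by blast

lemma is_adjoint_inner: "is_adjoint J K \<Longrightarrow> inner (J x) y = inner x (K y)"
  by (metis Re_cinner is_adjointD)

lemma is_adjoint_compose:
  "is_adjoint J K \<Longrightarrow> is_adjoint J' K' \<Longrightarrow> is_adjoint (J o\<^sub>L J') (K' o\<^sub>L K)"
  by (simp add: is_adjoint_def)

lemma is_adjoint_add:
  "is_adjoint J K \<Longrightarrow> is_adjoint J' K' \<Longrightarrow> is_adjoint (J + J') (K + K')"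
  by (simp add: is_adjoint_def blinfun.add_left cinner_add_left cinner_add_right)

lemma is_adjoint_diff:
  "is_adjoint J K \<Longrightarrow> is_adjoint J' K' \<Longrightarrow> is_adjoint (J - J') (K - K')"
  by (simp add: is_adjoint_def blinfun.diff_left cinner_diff_left cinner_diff_right)

lemma is_adjoint_scaleR: "is_adjoint J K \<Longrightarrow> is_adjoint (r *\<^sub>R J) (r *\<^sub>R K)"
  by (simp add: is_adjoint_def blinfun.scaleR_left cinner_scaleR_left cinner_scaleR_right)

lemma is_adjoint_0: "is_adjoint 0 0"
  by (simp add: is_adjoint_def)

lemma is_adjoint_id: "is_adjoint id_blinfun id_blinfun"
  by (simp add: is_adjoint_def)

lemma is_adjoint_sum:
  "(\<And>i. i \<in> I \<Longrightarrow> is_adjoint (J i) (K i)) \<Longrightarrow> is_adjoint (sum J I) (sum K I)"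
  by (induction I rule: infinite_finite_induct) (simp_all add: is_adjoint_0 is_adjoint_add)

lemmas is_adjoint_intros = is_adjoint_compose is_adjoint_add is_adjoint_diff is_adjoint_scaleR
  is_adjoint_0 is_adjoint_id is_adjoint_sum

lemma is_adjoint_limit:
  assumes "\<And>n. is_adjoint (J n) (K n)" "J \<longlonglongrightarrow> J'" "K \<longlonglongrightarrow> K'"
  shows "is_adjoint J' K'"
  unfolding is_adjoint_def
proof (intro allI)
  fix x y
  have "(\<lambda>n. cinner (J n x) y) \<longlonglongrightarrow> cinner (J' x) y"
    by (intro tendsto_cinner blinfun.tendsto assms tendsto_const)
  moreover have "(\<lambda>n. cinner x (K n y)) \<longlonglongrightarrow> cinner x (K' y)"
    by (intro tendsto_cinner blinfun.tendsto assms tendsto_const)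
  ultimately show "cinner (J' x) y = cinner x (K' y)"
    using assms(1) by (auto simp: is_adjoint_def intro: LIMSEQ_unique)
qed

lemma positive_op_iff:
  assumes "selfadjoint T" shows "positive_op T \<longleftrightarrow> (\<forall>x. 0 \<le> inner (T x) x)"
proof -
  have "Im (cinner (T x) x) = 0" for x
    using arg_cong[OF cinner_commute[of "T x" x], of Im] assms by (simp add: selfadjoint_def)
  then show ?thesis
    by (simp add: positive_op_def complex_nonneg_Reals_iff Re_cinner)
qed

lemma positive_opD: "positive_op T \<Longrightarrow> 0 \<le> inner (T x) x"
  by (simp add: positive_op_def complex_nonneg_Reals_iff Re_cinner)

lemma op_leD: "op_le S T \<Longrightarrow> inner (S x) x \<le> inner (T x) x"
  using positive_opD[of "T - S" x] by (simp add: op_le_def blinfun.diff_left inner_diff_left)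

section \<open>Self-adjoint operators on the range of a projection\<close>

definition selfadjoint_on :: "('h::complex_hilbert \<Rightarrow>\<^sub>L 'h) \<Rightarrow> ('h \<Rightarrow>\<^sub>L 'h) \<Rightarrow> bool" where
  "selfadjoint_on P T \<longleftrightarrow> orth_projection P \<and> op_on P T \<and> selfadjoint T"

text \<open>
  Only multiplication by \<open>P\<close> from the left has to be checked; from the right it follows by taking adjoints.
\<close>

lemma selfadjoint_onI:
  assumes "is_adjoint P P" "P o\<^sub>L P = P" "is_adjoint T T" "P o\<^sub>L T = T"
  shows "selfadjoint_on P T"
proof -
  have "T o\<^sub>L P = T"
  proof (rule blinfun_eqI)
    fix x
    have PT: "P (T z) = T z" for z
      using assms(4) by (metis blinfun_apply_blinfun_compose)
    show "(T o\<^sub>L P) x = T x"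
      by (rule cinner_ext) (simp add: PT is_adjointD[OF assms(1)] is_adjointD[OF assms(3)])
  qed
  then show ?thesis
    using assms unfolding selfadjoint_on_def orth_projection_def op_on_def selfadjoint_iff
    by (simp add: clinear_op_def is_adjoint_scaleC)
qed

lemma selfadjoint_onD:
  assumes "selfadjoint_on P T"
  shows "is_adjoint P P" "is_adjoint T T" "P (P x) = P x" "P (T x) = T x" "T (P x) = T x"
proof -
  show "is_adjoint P P" "is_adjoint T T"
    using assms by (auto simp: selfadjoint_on_def orth_projection_def selfadjoint_iff)
  have PP: "P (P y) = P y" for y
    using assms by (metis blinfun_apply_blinfun_compose selfadjoint_on_def orth_projection_def)
  then show "P (P x) = P x" .
  have PTP: "P (T (P y)) = T y" for y
    using assms by (metis blinfun_apply_blinfun_compose selfadjoint_on_def op_on_def)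
  show "P (T x) = T x" "T (P x) = T x"
    using PTP PP by metis+
qed

lemma selfadjoint_on_id: "selfadjoint_on id_blinfun T \<longleftrightarrow> selfadjoint T"
proof
  assume "selfadjoint T"
  then show "selfadjoint_on id_blinfun T"
    by (intro selfadjoint_onI is_adjoint_id) (auto simp: selfadjoint_iff intro: blinfun_eqI)
qed (simp add: selfadjoint_on_def)

lemma selfadjoint_on_self:
  assumes "selfadjoint_on P T" shows "selfadjoint_on P P"
  by (intro selfadjoint_onI selfadjoint_onD(1)[OF assms])
    (simp_all add: blinfun_eqI selfadjoint_onD[OF assms])

lemma selfadjoint_on_add:
  assumes "selfadjoint_on P S" "selfadjoint_on P T" shows "selfadjoint_on P (S + T)"
  by (intro selfadjoint_onI is_adjoint_add assms[THEN selfadjoint_onD(1)] assms[THEN selfadjoint_onD(2)])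
    (auto intro!: blinfun_eqI simp: blinfun.add_left blinfun.add_right
      selfadjoint_onD[OF assms(1)] selfadjoint_onD[OF assms(2)])

lemma selfadjoint_on_diff:
  assumes "selfadjoint_on P S" "selfadjoint_on P T" shows "selfadjoint_on P (S - T)"
  by (intro selfadjoint_onI is_adjoint_diff assms[THEN selfadjoint_onD(1)] assms[THEN selfadjoint_onD(2)])
    (auto intro!: blinfun_eqI simp: blinfun.diff_left blinfun.diff_right
      selfadjoint_onD[OF assms(1)] selfadjoint_onD[OF assms(2)])

lemma selfadjoint_on_scaleR:
  assumes "selfadjoint_on P S" shows "selfadjoint_on P (r *\<^sub>R S)"
  by (intro selfadjoint_onI is_adjoint_scaleR assms[THEN selfadjoint_onD(1)] assms[THEN selfadjoint_onD(2)])
    (auto intro!: blinfun_eqI simp: blinfun.scaleR_left blinfun.scaleR_right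
      selfadjoint_onD[OF assms(1)])

section \<open>Polynomials of an operator\<close>

text \<open>
  Evaluation of complex polynomials at an operator, applied to a vector. Complex coefficients are needed
  to split a polynomial into linear factors.
\<close>

definition ceval :: "('h::complex_hilbert \<Rightarrow>\<^sub>L 'h) \<Rightarrow> complex poly \<Rightarrow> 'h \<Rightarrow> 'h" where
  "ceval T q x = (\<Sum>i\<le>degree q. scaleC (coeff q i) ((blinfun_apply T ^^ i) x))"

lemma ceval_eq_sum:
  assumes "degree q \<le> n"
  shows "ceval T q x = (\<Sum>i\<le>n. scaleC (coeff q i) ((blinfun_apply T ^^ i) x))"
  unfolding ceval_def by (rule sum.mono_neutral_left) (use assms in \<open>auto simp: coeff_eq_0\<close>)

lemma ceval_0 [simp]: "ceval T 0 x = 0"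
  by (simp add: ceval_def)

lemma ceval_add: "ceval T (p + q) x = ceval T p x + ceval T q x"
proof -
  define n where "n = max (degree p) (degree q)"
  have "degree (p + q) \<le> n" "degree p \<le> n" "degree q \<le> n"
    by (auto simp: n_def degree_add_le)
  then show ?thesis
    by (simp add: ceval_eq_sum scaleC_add_left sum.distrib)
qed

lemma ceval_smult: "ceval T (smult c p) x = scaleC c (ceval T p x)"
  by (simp add: ceval_eq_sum[OF degree_smult_le] scaleC_sum_right scaleC_scaleC ceval_def)

lemma ceval_pCons:
  assumes "is_adjoint T T"
  shows "ceval T (pCons a p) x = scaleC a x + T (ceval T p x)"
proof -
  have "ceval T (pCons a p) x
    = (\<Sum>i\<le>Suc (degree p). scaleC (coeff (pCons a p) i) ((blinfun_apply T ^^ i) x))"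
    by (rule ceval_eq_sum) (simp add: degree_pCons_le)
  also have "\<dots> = scaleC a x + T (ceval T p x)"
    unfolding sum.atMost_Suc_shift ceval_def
    by (simp add: blinfun.sum_right is_adjoint_scaleC[OF assms])
  finally show ?thesis .
qed

lemma ceval_mult:
  assumes "is_adjoint T T"
  shows "ceval T (p * q) x = ceval T p (ceval T q x)"
proof (induction p)
  case (pCons a p)
  then show ?case
    by (simp add: mult_pCons_left ceval_add ceval_smult ceval_pCons[OF assms])
qed simp

lemma ceval_range:
  assumes "selfadjoint_on P T" "P x = x" shows "P (ceval T q x) = ceval T q x"
proof (induction q)
  case (pCons a q)
  then show ?case
    using assms(2)
    by (simp add: ceval_pCons selfadjoint_onD[OF assms(1)] blinfun.add_right
        is_adjoint_scaleC[OF selfadjoint_onD(1)[OF assms(1)]])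
qed simp

lemma ceval_minus: "ceval T (- p) x = - ceval T p x"
  using ceval_smult[of T "-1" p x] by (simp add: scaleC_minus_left)

lemma pow_on_apply: "pow_on P T n x = (blinfun_apply T ^^ n) (P x)"
  by (induction n) simp_all

lemma poly_on_apply:
  "poly_on P p T x = ceval T (map_poly of_real p) (P x)"
  by (simp add: poly_on_def ceval_def blinfun.sum_left blinfun.scaleR_left pow_on_apply
      scaleC_of_real degree_map_poly coeff_map_poly)

lemma is_adjoint_pow_on:
  assumes "selfadjoint_on P T" shows "is_adjoint (pow_on P T n) (pow_on P T n)"
proof -
  have *: "cinner ((blinfun_apply T ^^ n) x) y = cinner x ((blinfun_apply T ^^ n) y)" for x y
    by (induction n arbitrary: x y)
      (simp_all add: is_adjointD[OF selfadjoint_onD(2)[OF assms]] funpow_swap1)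
  have **: "P ((blinfun_apply T ^^ n) (P x)) = (blinfun_apply T ^^ n) (P x)" for x
    by (cases n) (simp_all add: selfadjoint_onD[OF assms])
  show ?thesis
    unfolding is_adjoint_def pow_on_apply
    by (metis * ** is_adjointD[OF selfadjoint_onD(1)[OF assms]])
qed

lemma selfadjoint_on_poly_on:
  assumes "selfadjoint_on P T" shows "selfadjoint_on P (poly_on P p T)"
proof (rule selfadjoint_onI)
  show "is_adjoint (poly_on P p T) (poly_on P p T)"
    unfolding poly_on_def by (intro is_adjoint_intros is_adjoint_pow_on assms)
  show "P o\<^sub>L poly_on P p T = poly_on P p T"
    by (rule blinfun_eqI)
      (simp add: poly_on_apply ceval_range[OF assms] selfadjoint_onD[OF assms])
  show "P o\<^sub>L P = P"
    using assms by (simp add: selfadjoint_on_def orth_projection_def)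
qed (use assms in \<open>rule selfadjoint_onD\<close>)

section \<open>The norm of a polynomial in a self-adjoint operator\<close>

definition bdd_below_on ::
  "('h::complex_hilbert \<Rightarrow>\<^sub>L 'h) \<Rightarrow> ('h \<Rightarrow> 'h) \<Rightarrow> bool" where
  "bdd_below_on P F \<longleftrightarrow> (\<exists>\<delta>>0. \<forall>x. P x = x \<longrightarrow> \<delta> * norm x \<le> norm (F x))"

lemma bdd_below_on_compose:
  assumes "bdd_below_on P F" "bdd_below_on P G" "\<And>x. P x = x \<Longrightarrow> P (G x) = G x"
  shows "bdd_below_on P (\<lambda>x. F (G x))"
proof -
  from assms obtain d e where d: "d > 0" "\<And>x. P x = x \<Longrightarrow> d * norm x \<le> norm (F x)"
    and e: "e > 0" "\<And>x. P x = x \<Longrightarrow> e * norm x \<le> norm (G x)"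
    unfolding bdd_below_on_def by blast
  have "(d * e) * norm x \<le> norm (F (G x))" if "P x = x" for x
    using order_trans[OF mult_left_mono[OF e(2)[OF that]] d(2)[OF assms(3)[OF that]]] d(1)
    by (simp add: mult.assoc)
  then show ?thesis
    using d(1) e(1) unfolding bdd_below_on_def by (intro exI[of _ "d * e"]) simp
qed

text \<open>
  A composition of maps that are bounded below is bounded below, so splitting \<open>q\<close> into linear
  factors reduces the claim to these factors.
\<close>

lemma bdd_below_on_ceval:
  assumes T: "selfadjoint_on P T" and "q \<noteq> 0"
    and "\<And>\<alpha>. poly q \<alpha> = 0 \<Longrightarrow> bdd_below_on P (\<lambda>x. T x - scaleC \<alpha> x)"
  shows "bdd_below_on P (ceval T q)"
  using assms(2,3)
proof (induction "degree q" arbitrary: q)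
  case 0
  then obtain c where c: "q = [:c:]"
    by (metis degree_eq_zeroE)
  with 0 have "c \<noteq> 0"
    by simp
  moreover have "ceval T q x = scaleC c x" for x
    by (simp add: c ceval_pCons[OF selfadjoint_onD(2)[OF T]])
  ultimately show ?case
    unfolding bdd_below_on_def by (intro exI[of _ "cmod c"]) (simp add: norm_scaleC)
next
  case (Suc n)
  have "\<not> constant (poly q)"
    using Suc.hyps(2) by (simp add: constant_degree)
  then obtain \<alpha> where \<alpha>: "poly q \<alpha> = 0"
    using fundamental_theorem_of_algebra by blast
  then obtain r where r: "q = [:-\<alpha>, 1:] * r"
    by (metis poly_eq_0_iff_dvd dvdE)
  have "r \<noteq> 0"
    using Suc.prems(1) r by auto
  moreover have "n = degree r"
    using Suc.hyps(2) \<open>r \<noteq> 0\<close> unfolding r by (subst (asm) degree_mult_eq) auto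
  ultimately have "bdd_below_on P (ceval T r)"
    using Suc.hyps(1) Suc.prems(2) r by auto
  then have "bdd_below_on P (\<lambda>x. T (ceval T r x) - scaleC \<alpha> (ceval T r x))"
    by (rule bdd_below_on_compose[OF Suc.prems(2)[OF \<alpha>]]) (rule ceval_range[OF T])
  moreover have "ceval T q = (\<lambda>x. T (ceval T r x) - scaleC \<alpha> (ceval T r x))"
    unfolding r ceval_mult[OF selfadjoint_onD(2)[OF T]]
    by (simp add: ceval_pCons[OF selfadjoint_onD(2)[OF T]] scaleC_minus_left)
  ultimately show ?case
    by simp
qed

text \<open>
  The imaginary part of \<open>\<langle>(T - \<alpha>)x, x\<rangle>\<close> is \<open>- Im \<alpha> \<cdot> \<parallel>x\<parallel>\<^sup>2\<close>, because \<open>\<langle>Tx, x\<rangle>\<close> is real.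
\<close>

lemma bdd_below_on_nonreal:
  assumes T: "selfadjoint_on P T" and "Im \<alpha> \<noteq> 0"
  shows "bdd_below_on P (\<lambda>x. T x - scaleC \<alpha> x)"
  unfolding bdd_below_on_def
proof (intro exI[of _ "\<bar>Im \<alpha>\<bar>"] conjI allI impI)
  fix x
  have "Im (cinner (T x) x) = 0"
    using arg_cong[OF cinner_commute[of "T x" x], of Im] is_adjointD[OF selfadjoint_onD(2)[OF T]]
    by simp
  then have "Im (cinner (T x - scaleC \<alpha> x) x) = - Im \<alpha> * (norm x)\<^sup>2"
    by (simp add: cinner_diff_left cinner_scaleC_left cinner_self del: of_real_power)
  moreover have "\<bar>Im (cinner (T x - scaleC \<alpha> x) x)\<bar> \<le> norm (T x - scaleC \<alpha> x) * norm x"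
    using Cauchy_Schwarz_ineq2[of "T x - scaleC \<alpha> x" "scaleC \<i> x"]
    by (simp add: Im_cinner norm_scaleC)
  ultimately have "(\<bar>Im \<alpha>\<bar> * norm x) * norm x \<le> norm (T x - scaleC \<alpha> x) * norm x"
    by (simp add: abs_mult power2_eq_square mult.assoc)
  then show "\<bar>Im \<alpha>\<bar> * norm x \<le> norm (T x - scaleC \<alpha> x)"
    by (cases "x = 0") simp_all
qed (use assms(2) in simp)

lemma invertible_on_bdd_below:
  assumes "invertible_on P S" shows "bdd_below_on P (blinfun_apply S)"
proof -
  from assms obtain R where R: "R o\<^sub>L S = P"
    unfolding invertible_on_def by blast
  have "inverse (norm R + 1) * norm x \<le> norm (S x)" if "P x = x" for x
  proof -
    have "norm x = norm (R (S x))"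
      using R that by (metis blinfun_apply_blinfun_compose)
    also have "\<dots> \<le> norm R * norm (S x)"
      by (rule norm_blinfun)
    also have "\<dots> \<le> (norm R + 1) * norm (S x)"
      by (simp add: distrib_right)
    finally show ?thesis
      by (simp add: field_simps add_pos_nonneg)
  qed
  then show ?thesis
    unfolding bdd_below_on_def by (intro exI[of _ "inverse (norm R + 1)"]) (simp add: add_nonneg_pos)
qed

lemma not_bdd_below_in_spectrum:
  assumes T: "selfadjoint_on P T" and "\<not> bdd_below_on P (\<lambda>x. T x - scaleC \<alpha> x)"
  shows "\<alpha> \<in> spectrum_on P T" "Im \<alpha> = 0"
proof -
  show "Im \<alpha> = 0"
    using assms bdd_below_on_nonreal by blast
  have "bdd_below_on P (\<lambda>x. T x - scaleC \<alpha> x)"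
    if "bdd_below_on P (blinfun_apply (T - (scalar_op \<alpha> o\<^sub>L P)))"
    using that by (simp add: bdd_below_on_def blinfun.diff_left scalar_op.rep_eq)
  then show "\<alpha> \<in> spectrum_on P T"
    using assms(2) invertible_on_bdd_below unfolding spectrum_on_def by blast
qed

lemma norm_projection_le:
  assumes "selfadjoint_on P T" shows "norm (P x) \<le> norm x"
proof -
  have "norm (P x) * norm (P x) = inner (P x) (P x)"
    by (simp add: dot_square_norm power2_eq_square)
  also have "\<dots> = inner (P x) x"
    using is_adjoint_inner[OF selfadjoint_onD(1)[OF assms], of "P x" x]
    by (simp add: selfadjoint_onD[OF assms])
  also have "\<dots> \<le> norm (P x) * norm x"
    by (rule norm_cauchy_schwarz)
  finally show ?thesis
    by (cases "P x = 0") simp_all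
qed

text \<open>
  On unit vectors with \<open>\<parallel>Sx\<parallel> \<rightarrow> \<parallel>S\<parallel> = N\<close> one has
  \<open>\<parallel>(N\<^sup>2 - S\<^sup>2)x\<parallel>\<^sup>2 \<le> N\<^sup>2(N\<^sup>2 - \<parallel>Sx\<parallel>\<^sup>2) \<rightarrow> 0\<close>.
  Read the other way round, a lower bound for \<open>N\<^sup>2 - S\<^sup>2\<close> gives \<open>S\<close> a norm smaller than \<open>N\<close>.
\<close>

lemma not_bdd_below_norm_square:
  assumes S: "selfadjoint_on P S" and "P \<noteq> 0"
  shows "\<not> bdd_below_on P (\<lambda>x. (norm S)\<^sup>2 *\<^sub>R x - S (S x))"
proof
  define N where "N = norm S"
  assume "bdd_below_on P (\<lambda>x. (norm S)\<^sup>2 *\<^sub>R x - S (S x))"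
  then obtain d where d: "d > 0" and le: "\<And>x. P x = x \<Longrightarrow> d * norm x \<le> norm (N\<^sup>2 *\<^sub>R x - S (S x))"
    unfolding bdd_below_on_def N_def by blast
  obtain y where y: "P y \<noteq> 0"
    using \<open>P \<noteq> 0\<close> by (metis blinfun_eqI zero_blinfun.rep_eq)
  have key: "d\<^sup>2 * (norm x)\<^sup>2 \<le> N\<^sup>2 * (N\<^sup>2 * (norm x)\<^sup>2 - (norm (S x))\<^sup>2)" if "P x = x" for x
  proof -
    have "(d * norm x)\<^sup>2 \<le> (norm (N\<^sup>2 *\<^sub>R x - S (S x)))\<^sup>2"
      using le[OF that] d by (intro power_mono) auto
    also have "\<dots> = N^4 * (norm x)\<^sup>2 - 2 * N\<^sup>2 * inner x (S (S x)) + (norm (S (S x)))\<^sup>2"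
      unfolding power2_norm_eq_inner by (simp add: inner_diff_left inner_diff_right inner_commute algebra_simps
          power4_eq_xxxx power2_eq_square)
    also have "inner x (S (S x)) = (norm (S x))\<^sup>2"
      using is_adjoint_inner[OF selfadjoint_onD(2)[OF S], of x "S x"] by (simp add: dot_square_norm)
    also have "(norm (S (S x)))\<^sup>2 \<le> (N * norm (S x))\<^sup>2"
      unfolding N_def by (intro power_mono norm_blinfun) auto
    finally show ?thesis
      by (simp add: power_mult_distrib algebra_simps power4_eq_xxxx power2_eq_square)
  qed
  have "N \<noteq> 0"
  proof
    assume "N = 0"
    then have "d\<^sup>2 * (norm (P y))\<^sup>2 \<le> 0"
      using key[of "P y"] by (simp add: selfadjoint_onD[OF S])
    moreover have "0 < d\<^sup>2 * (norm (P y))\<^sup>2"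
      using y d by simp
    ultimately show False
      by linarith
  qed
  define c where "c = N\<^sup>2 - d\<^sup>2 / N\<^sup>2"
  have c: "(norm (S x))\<^sup>2 \<le> c * (norm x)\<^sup>2" if "P x = x" for x
  proof -
    have "N\<^sup>2 * c = N\<^sup>2 * N\<^sup>2 - d\<^sup>2"
      using \<open>N \<noteq> 0\<close> by (simp add: c_def right_diff_distrib)
    then have "N\<^sup>2 * (c * (norm x)\<^sup>2) = (N\<^sup>2 * N\<^sup>2 - d\<^sup>2) * (norm x)\<^sup>2"
      by (metis mult.assoc)
    then have "N\<^sup>2 * (norm (S x))\<^sup>2 \<le> N\<^sup>2 * (c * (norm x)\<^sup>2)"
      using key[OF that] by (simp add: algebra_simps)
    then show ?thesis
      using \<open>N \<noteq> 0\<close> by simp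
  qed
  have "c \<ge> 0"
    using order_trans[OF zero_le_power2 c[of "P y"]] y
    by (simp add: selfadjoint_onD[OF S] zero_le_mult_iff)
  have "norm (S x) \<le> sqrt c * norm x" for x
  proof -
    have "(norm (S x))\<^sup>2 \<le> c * (norm (P x))\<^sup>2"
      using c[of "P x"] by (simp add: selfadjoint_onD[OF S])
    then have "norm (S x) \<le> sqrt c * norm (P x)"
      using \<open>c \<ge> 0\<close> by - (rule power2_le_imp_le, simp_all add: power_mult_distrib)
    also have "\<dots> \<le> sqrt c * norm x"
      using \<open>c \<ge> 0\<close> norm_projection_le[OF S] by (intro mult_left_mono) auto
    finally show ?thesis .
  qed
  then have "N \<le> sqrt c"
    unfolding N_def using \<open>c \<ge> 0\<close> by (intro norm_blinfun_bound) auto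
  then have "N\<^sup>2 \<le> c"
    using \<open>c \<ge> 0\<close> N_def by (metis norm_ge_zero power_mono real_sqrt_pow2)
  then show False
    using d \<open>N \<noteq> 0\<close> by (simp add: c_def) (smt (verit) divide_pos_pos zero_less_power2)
qed

text \<open>
  With \<open>N\<close> the norm of \<open>p(T)\<close>, the operator \<open>N\<^sup>2 - p(T)\<^sup>2\<close> is not bounded below, so
  \<open>T - \<alpha>\<close> is not bounded below for some complex root \<open>\<alpha>\<close> of \<open>N\<^sup>2 - p\<^sup>2\<close>. Such an \<open>\<alpha>\<close> is
  real and lies in the spectrum.
\<close>

lemma norm_poly_on_attained_nonconst:
  assumes T: "selfadjoint_on P T" and "P \<noteq> 0"
    and nz: "[:(norm (poly_on P p T))\<^sup>2:] - p * p \<noteq> 0"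
  shows "\<exists>\<alpha>. complex_of_real \<alpha> \<in> spectrum_on P T \<and> \<bar>poly p \<alpha>\<bar> = norm (poly_on P p T)"
proof -
  define S where "S = poly_on P p T"
  define pc where "pc = map_poly complex_of_real p"
  define q where "q = [:of_real ((norm S)\<^sup>2):] - pc * pc"
  have q_real: "poly q (of_real a) = of_real (poly ([:(norm S)\<^sup>2:] - p * p) a)" for a
  proof -
    have "poly pc (of_real a) = of_real (poly p a)"
      by (simp add: pc_def poly_altdef degree_map_poly coeff_map_poly)
    then show ?thesis
      by (simp add: q_def)
  qed
  have "q \<noteq> 0"
  proof
    assume "q = 0"
    then have "poly ([:(norm S)\<^sup>2:] - p * p) a = 0" for a
      using q_real[of a] by (metis of_real_eq_0_iff poly_0)
    then show False
      using nz unfolding S_def by (metis poly_0 poly_eq_poly_eq_iff ext)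
  qed
  have ev: "ceval T pc x = S x" if "P x = x" for x
    using that by (simp add: S_def pc_def poly_on_apply)
  have "ceval T q x = (norm S)\<^sup>2 *\<^sub>R x - S (S x)" if "P x = x" for x
  proof -
    have "ceval T q x = ceval T [:of_real ((norm S)\<^sup>2):] x + ceval T (- (pc * pc)) x"
      by (simp only: q_def diff_conv_add_uminus ceval_add[symmetric])
    also have "\<dots> = (norm S)\<^sup>2 *\<^sub>R x - ceval T pc (ceval T pc x)"
      by (simp add: ceval_minus ceval_mult ceval_pCons selfadjoint_onD[OF T] scaleC_of_real
          scaleC_minus_left del: of_real_power)
    finally show ?thesis
      using ev[OF that] ev[of "S x"] ceval_range[OF T that, of pc] by simp
  qed
  then have "bdd_below_on P (ceval T q) \<longleftrightarrow> bdd_below_on P (\<lambda>x. (norm S)\<^sup>2 *\<^sub>R x - S (S x))"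
    by (simp add: bdd_below_on_def)
  then have "\<not> bdd_below_on P (ceval T q)"
    using not_bdd_below_norm_square[OF _ \<open>P \<noteq> 0\<close>] selfadjoint_on_poly_on[OF T] S_def by blast
  then obtain \<alpha> where \<alpha>: "poly q \<alpha> = 0" "\<not> bdd_below_on P (\<lambda>x. T x - scaleC \<alpha> x)"
    using bdd_below_on_ceval[OF T \<open>q \<noteq> 0\<close>] by blast
  note sp = not_bdd_below_in_spectrum[OF T \<alpha>(2)]
  then have eq: "\<alpha> = of_real (Re \<alpha>)"
    by (simp add: complex_eq_iff)
  have "poly ([:(norm S)\<^sup>2:] - p * p) (Re \<alpha>) = 0"
    using \<alpha>(1) q_real[of "Re \<alpha>"] eq by (metis of_real_eq_0_iff)
  then have "(poly p (Re \<alpha>))\<^sup>2 = (norm S)\<^sup>2"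
    by (simp add: power2_eq_square)
  then have "\<bar>poly p (Re \<alpha>)\<bar> = norm S"
    by (metis abs_norm_cancel power2_eq_iff abs_minus_cancel)
  then show ?thesis
    using sp(1) eq S_def by metis
qed

text \<open>
  When \<open>p\<^sup>2\<close> is the constant \<open>N\<^sup>2\<close>, every spectral value will do, and it only matters that the
  spectrum is nonempty. This follows from the preceding lemma for the polynomial \<open>[:0, 1:]\<close>.
\<close>

lemma norm_poly_on_attained:
  assumes T: "selfadjoint_on P T" and "P \<noteq> 0"
  obtains \<alpha> where "complex_of_real \<alpha> \<in> spectrum_on P T" "\<bar>poly p \<alpha>\<bar> = norm (poly_on P p T)"
proof (cases "[:(norm (poly_on P p T))\<^sup>2:] - p * p = 0")
  case True
  have "[:c:] - [:0, 1:] * [:0, 1:] \<noteq> (0 :: real poly)" for c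
    by simp
  from norm_poly_on_attained_nonconst[OF T \<open>P \<noteq> 0\<close> this] obtain \<alpha>
    where "complex_of_real \<alpha> \<in> spectrum_on P T"
    by blast
  moreover have "poly ([:(norm (poly_on P p T))\<^sup>2:] - p * p) \<alpha> = 0"
    using True by simp
  then have "(poly p \<alpha>)\<^sup>2 = (norm (poly_on P p T))\<^sup>2"
    by (simp add: power2_eq_square)
  then have "\<bar>poly p \<alpha>\<bar> = norm (poly_on P p T)"
    by (metis abs_norm_cancel power2_eq_iff abs_minus_cancel)
  ultimately show ?thesis
    using that by blast
next
  case False
  then show ?thesis
    using norm_poly_on_attained_nonconst[OF assms] that by blast
qed

section \<open>Spectrum and quadratic form\<close>

lemma blinfun_compose_assoc: "(S o\<^sub>L T) o\<^sub>L U = S o\<^sub>L (T o\<^sub>L U)"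
  by (rule blinfun_eqI) simp

lemma invertible_on_minus:
  assumes "invertible_on P (- S)" shows "invertible_on P S"
proof -
  from assms obtain R where R: "op_on P R" "R o\<^sub>L (- S) = P" "(- S) o\<^sub>L R = P"
    unfolding invertible_on_def by blast
  have "P o\<^sub>L (- R) o\<^sub>L P = - (P o\<^sub>L R o\<^sub>L P)"
    by (rule blinfun_eqI) (simp add: blinfun.minus_left blinfun.minus_right)
  then have "op_on P (- R)"
    using R(1) by (simp add: op_on_def clinear_op_def blinfun.minus_left scaleC_diff_right[of _ 0, simplified])
  moreover have "(- R) o\<^sub>L S = R o\<^sub>L (- S)" "S o\<^sub>L (- R) = (- S) o\<^sub>L R"
    by (rule blinfun_eqI, simp add: blinfun.minus_left blinfun.minus_right)+
  ultimately show ?thesis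
    using R(2,3) unfolding invertible_on_def by metis
qed

text \<open>
  The equation \<open>Sx = y\<close> says that \<open>x\<close> is a fixed point of \<open>x \<mapsto> x - c(Sx - y)\<close>. For a small constant
  \<open>c > 0\<close> coercivity makes this map a contraction, and \<open>c = \<delta> / N\<^sup>2\<close> minimises the
  contraction constant when \<open>S\<close> has norm at most \<open>N\<close>.
\<close>

lemma coercive_surj:
  fixes S :: "'h::{real_inner, banach} \<Rightarrow>\<^sub>L 'h"
  assumes "\<delta> > 0" and coercive: "\<And>x. \<delta> * (norm x)\<^sup>2 \<le> inner (S x) x"
  shows "\<exists>x. S x = y"
proof -
  define N where "N = norm S + \<delta>"
  define c where "c = \<delta> / N\<^sup>2"
  define k where "k = sqrt (1 - c * \<delta>)"
  have N: "N > 0" "\<delta> \<le> N"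
    using \<open>\<delta> > 0\<close> by (simp_all add: N_def add_nonneg_pos)
  have c: "c > 0" "c * N\<^sup>2 = \<delta>"
    using N \<open>\<delta> > 0\<close> by (simp_all add: c_def)
  have "\<delta> * \<delta> \<le> N\<^sup>2"
    using N \<open>\<delta> > 0\<close> by (simp add: power2_eq_square mult_mono)
  then have c1: "c * \<delta> \<le> 1"
    using N by (simp add: c_def)
  then have k: "0 \<le> k" "k < 1" "k\<^sup>2 = 1 - c * \<delta>"
    using c(1) \<open>\<delta> > 0\<close> by (simp_all add: k_def)
  have contr: "norm (x - c *\<^sub>R S x) \<le> k * norm x" for x
  proof -
    have "norm (S x) \<le> N * norm x"
      using norm_blinfun[of S x] \<open>\<delta> > 0\<close> by (simp add: N_def distrib_right add_increasing2)
    then have "(norm (S x))\<^sup>2 \<le> N\<^sup>2 * (norm x)\<^sup>2"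
      by (metis norm_ge_zero power_mono power_mult_distrib)
    then have 1: "c\<^sup>2 * (norm (S x))\<^sup>2 \<le> c\<^sup>2 * (N\<^sup>2 * (norm x)\<^sup>2)"
      by (intro mult_left_mono) auto
    have "c\<^sup>2 * (N\<^sup>2 * (norm x)\<^sup>2) = c * (c * N\<^sup>2) * (norm x)\<^sup>2"
      by (simp add: power2_eq_square)
    also have "\<dots> = c * (\<delta> * (norm x)\<^sup>2)"
      using c(2) by simp
    finally have 2: "c\<^sup>2 * (N\<^sup>2 * (norm x)\<^sup>2) = c * (\<delta> * (norm x)\<^sup>2)" .
    have 3: "c * (\<delta> * (norm x)\<^sup>2) \<le> c * inner (S x) x"
      using coercive c(1) by simp
    have "(norm (x - c *\<^sub>R S x))\<^sup>2 = (norm x)\<^sup>2 - 2 * (c * inner (S x) x) + c\<^sup>2 * (norm (S x))\<^sup>2"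
      unfolding power2_norm_eq_inner
      by (simp add: inner_diff_left inner_diff_right inner_commute algebra_simps power2_eq_square)
    also have "\<dots> \<le> (k * norm x)\<^sup>2"
      using 1 2 3 by (simp add: power_mult_distrib k(3) left_diff_distrib mult.assoc)
    finally show ?thesis
      using k by - (rule power2_le_imp_le, auto)
  qed
  define f where "f x = (x - c *\<^sub>R S x) + c *\<^sub>R y" for x
  have "dist (f u) (f v) \<le> k * dist u v" for u v
    using contr[of "u - v"] by (simp add: f_def dist_norm blinfun.diff_right algebra_simps)
  then obtain x where "f x = x"
    using banach_fix_type[OF k(1,2), of f] by blast
  then have "S x = y"
    using c(1) by (auto simp: f_def algebra_simps)
  then show ?thesis
    by blast
qed

text \<open>
  Adding the projection onto the orthogonal complement of the range of \<open>P\<close> makes \<open>S\<close> coercive on the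
  whole space; the inverse of this extension is then compressed to the range of \<open>P\<close>.
\<close>

lemma coercive_invertible_on:
  assumes S: "selfadjoint_on P S" and "\<delta> > 0"
    and coercive: "\<And>x. \<delta> * (norm (P x))\<^sup>2 \<le> inner (S x) x"
  shows "invertible_on P S"
proof -
  note S_simps = selfadjoint_onD[OF S]
  define S' where "S' = S + (id_blinfun - P)"
  define d where "d = min \<delta> 1"
  have "d > 0"
    using \<open>\<delta> > 0\<close> by (simp add: d_def)
  have adj: "is_adjoint S' S'"
    unfolding S'_def by (intro is_adjoint_intros S_simps)
  have coercive': "d * (norm x)\<^sup>2 \<le> inner (S' x) x" for x
  proof -
    have px: "inner (P x) x = (norm (P x))\<^sup>2"
      using is_adjoint_inner[OF S_simps(1), of "P x" x] by (simp add: S_simps dot_square_norm)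
    have "d * (norm x)\<^sup>2 = d * (norm (P x))\<^sup>2 + d * ((norm x)\<^sup>2 - (norm (P x))\<^sup>2)"
      by (simp add: algebra_simps)
    also have "\<dots> \<le> \<delta> * (norm (P x))\<^sup>2 + 1 * ((norm x)\<^sup>2 - (norm (P x))\<^sup>2)"
      using norm_projection_le[OF S]
      by (intro add_mono mult_right_mono) (auto simp: d_def power_mono)
    also have "\<dots> \<le> inner (S' x) x"
      using coercive[of x]
      by (simp add: S'_def blinfun.add_left blinfun.diff_left inner_add_left inner_diff_left px
          dot_square_norm)
    finally show ?thesis .
  qed
  have inj: "u = v" if "S' u = S' v" for u v
    using coercive'[of "u - v"] that \<open>d > 0\<close> by (simp add: blinfun.diff_right mult_le_0_iff)
  obtain f where f: "\<And>y. S' (f y) = y"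
    using coercive_surj[OF \<open>d > 0\<close> coercive'] by metis
  have "bounded_linear f"
  proof (rule bounded_linear_intro[where K = "1 / d"])
    show "f (x + y) = f x + f y" for x y
      by (rule inj) (simp add: f blinfun.add_right)
    show "f (r *\<^sub>R x) = r *\<^sub>R f x" for r x
      by (rule inj) (simp add: f blinfun.scaleR_right)
    show "norm (f x) \<le> norm x * (1 / d)" for x
    proof -
      have "d * (norm (f x))\<^sup>2 \<le> norm x * norm (f x)"
        using coercive'[of "f x"] norm_cauchy_schwarz[of x "f x"] by (simp add: f)
      then have "d * norm (f x) \<le> norm x"
        by (cases "f x = 0") (simp_all add: power2_eq_square mult.assoc[symmetric])
      then show ?thesis
        using \<open>d > 0\<close> by (simp add: field_simps)
    qed
  qed
  then have F: "blinfun_apply (Blinfun f) = f"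
    by (rule bounded_linear_Blinfun_apply)
  have "is_adjoint (Blinfun f) (Blinfun f)"
    unfolding is_adjoint_def F by (metis adj f is_adjointD)
  then have R_adj: "is_adjoint (P o\<^sub>L Blinfun f o\<^sub>L P) (P o\<^sub>L Blinfun f o\<^sub>L P)"
    using is_adjoint_compose[OF is_adjoint_compose[OF S_simps(1)] S_simps(1)]
    by (simp add: blinfun_compose_assoc)
  define R where "R = P o\<^sub>L Blinfun f o\<^sub>L P"
  have R: "R x = P (f (P x))" for x
    by (simp add: R_def F)
  have "clinear_op R"
    using R_adj unfolding R_def[symmetric] clinear_op_def by (simp add: is_adjoint_scaleC)
  then have "op_on P R"
    by (auto simp: op_on_def R S_simps intro!: blinfun_eqI)
  moreover have "R o\<^sub>L S = P"
  proof (rule blinfun_eqI)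
    fix x
    have "S' (P x) = S x"
      by (simp add: S'_def blinfun.add_left blinfun.diff_left S_simps)
    then have "f (S x) = P x"
      using inj f by metis
    then show "(R o\<^sub>L S) x = P x"
      by (simp add: R S_simps)
  qed
  moreover have "S o\<^sub>L R = P"
  proof (rule blinfun_eqI)
    fix x
    have "P (S' (f (P x))) = P (P x)"
      by (simp add: f)
    then show "(S o\<^sub>L R) x = P x"
      by (simp add: R S_simps S'_def blinfun.add_left blinfun.diff_left blinfun.add_right
          blinfun.diff_right)
  qed
  ultimately show ?thesis
    unfolding invertible_on_def by blast
qed

lemma invertible_onI:
  assumes "op_on P L" "op_on P R" "L o\<^sub>L X = P" "X o\<^sub>L R = P" "P o\<^sub>L P = P"
  shows "invertible_on P X"
proof -
  have LP: "L o\<^sub>L P = L" and PR: "P o\<^sub>L R = R"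
    using assms(1,2,5) unfolding op_on_def by (metis blinfun_compose_assoc)+
  have "L = L o\<^sub>L (X o\<^sub>L R)"
    using LP assms(4) by simp
  also have "\<dots> = R"
    using PR assms(3) by (simp add: blinfun_compose_assoc[symmetric])
  finally show ?thesis
    using assms unfolding invertible_on_def by blast
qed

text \<open>
  For \<open>z = a + ib\<close> with \<open>b \<noteq> 0\<close> the operator
  \<open>(T - z)(T - cnj z) = (T - a)\<^sup>2 + b\<^sup>2\<close> is coercive, and its
  inverse yields a left and a right inverse of \<open>T - z\<close>.
\<close>

lemma spectrum_on_real:
  assumes T: "selfadjoint_on P T" and z: "z \<in> spectrum_on P T"
  shows "Im z = 0"
proof (rule ccontr)
  assume "Im z \<noteq> 0"
  note T_simps = selfadjoint_onD[OF T]
  note T_scaleC = is_adjoint_scaleC[OF T_simps(1)] is_adjoint_scaleC[OF T_simps(2)]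
  define a where "a = T - Re z *\<^sub>R P"
  have a: "selfadjoint_on P a"
    unfolding a_def by (intro selfadjoint_on_diff selfadjoint_on_scaleR T selfadjoint_on_self[OF T])
  note a_simps = selfadjoint_onD[OF a]
  note a_scaleC = is_adjoint_scaleC[OF a_simps(2)]
  define S where "S = (a o\<^sub>L a) + (Im z)\<^sup>2 *\<^sub>R P"
  have aa: "selfadjoint_on P (a o\<^sub>L a)"
    by (intro selfadjoint_onI is_adjoint_compose a_simps)
      (auto intro!: blinfun_eqI simp: a_simps)
  have S: "selfadjoint_on P S"
    unfolding S_def by (intro selfadjoint_on_add selfadjoint_on_scaleR aa selfadjoint_on_self[OF T])
  have "(Im z)\<^sup>2 * (norm (P x))\<^sup>2 \<le> inner (S x) x" for x
    using is_adjoint_inner[OF a_simps(2), of "a x" x] is_adjoint_inner[OF T_simps(1), of "P x" x]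
    by (simp add: S_def blinfun.add_left blinfun.scaleR_left inner_add_left T_simps dot_square_norm)
  then have "invertible_on P S"
    using S \<open>Im z \<noteq> 0\<close> by (intro coercive_invertible_on[where \<delta> = "(Im z)\<^sup>2"]) auto
  then obtain R where R: "op_on P R" "R o\<^sub>L S = P" "S o\<^sub>L R = P"
    unfolding invertible_on_def by blast
  define X where "X w = T - (scalar_op w o\<^sub>L P)" for w
  have X: "X w x = T x - scaleC w (P x)" for w x
    by (simp add: X_def blinfun.diff_left scalar_op.rep_eq)
  have X_op: "op_on P (X w)" for w
    by (auto simp: op_on_def clinear_op_def X T_scaleC T_simps scaleC_diff_right blinfun.diff_right
        scaleC_scaleC mult.commute intro!: blinfun_eqI)
  have op_comp: "op_on P (U o\<^sub>L V)" if "op_on P U" "op_on P V" for U V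
  proof -
    have PP: "P o\<^sub>L P = P"
      using T by (simp add: selfadjoint_on_def orth_projection_def)
    have "P o\<^sub>L U = U" "V o\<^sub>L P = V"
      using that PP unfolding op_on_def by (metis blinfun_compose_assoc)+
    then have "P o\<^sub>L (U o\<^sub>L V) o\<^sub>L P = U o\<^sub>L V"
      by (metis blinfun_compose_assoc)
    then show ?thesis
      using that by (simp add: op_on_def clinear_op_def)
  qed
  have prod: "X (cnj w) (X w x) = S x" if "w = z \<or> w = cnj z" for w x
  proof -
    have "scaleC (cnj w) (T x) + scaleC w (T x) = (2 * Re z) *\<^sub>R T x"
      using that by (auto simp: scaleC_add_left[symmetric] scaleC_of_real[symmetric] complex_add_cnj add.commute)
    moreover have "scaleC (cnj w) (scaleC w (P x)) = ((Re z)\<^sup>2 + (Im z)\<^sup>2) *\<^sub>R P x"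
      using that by (auto simp: scaleC_scaleC scaleC_of_real[symmetric] complex_mult_cnj mult.commute)
    ultimately have "X (cnj w) (X w x)
        = T (T x) - (2 * Re z) *\<^sub>R T x + ((Re z)\<^sup>2 + (Im z)\<^sup>2) *\<^sub>R P x"
      by (simp add: X T_simps T_scaleC blinfun.diff_right scaleC_diff_right algebra_simps)
    also have "\<dots> = S x"
      unfolding mult_2 scaleR_left_distrib
      by (simp add: S_def a_def blinfun.add_left blinfun.diff_left blinfun.scaleR_left
          blinfun.diff_right blinfun.scaleR_right T_simps algebra_simps power2_eq_square)
    finally show ?thesis .
  qed
  have "invertible_on P (X z)"
  proof (rule invertible_onI)
    show "op_on P (R o\<^sub>L X (cnj z))" "op_on P (X (cnj z) o\<^sub>L R)"
      by (intro op_comp R(1) X_op)+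
    show "R o\<^sub>L X (cnj z) o\<^sub>L X z = P"
      unfolding R(2)[symmetric] using prod[of z] by (intro blinfun_eqI) simp
    show "X z o\<^sub>L (X (cnj z) o\<^sub>L R) = P"
      unfolding R(3)[symmetric] using prod[of "cnj z"] by (intro blinfun_eqI) simp
    show "P o\<^sub>L P = P"
      using T by (simp add: selfadjoint_on_def orth_projection_def)
  qed
  then show False
    using z by (simp add: spectrum_on_def X_def)
qed

text \<open>
  The operator inequalities \<open>lo \<le> T \<le> hi\<close> on the range of \<open>P\<close>. They are used in place of the inclusion of
  the spectrum in \<open>[lo, hi]\<close>, since they pass to compressions, convex combinations and direct sums at once.
\<close>

definition form_between ::
  "('h::complex_hilbert \<Rightarrow>\<^sub>L 'h) \<Rightarrow> ('h \<Rightarrow>\<^sub>L 'h) \<Rightarrow> real \<Rightarrow> real \<Rightarrow> bool" where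
  "form_between P T lo hi \<longleftrightarrow>
     (\<forall>x. lo * (norm (P x))\<^sup>2 \<le> inner (T x) x \<and> inner (T x) x \<le> hi * (norm (P x))\<^sup>2)"

lemma inner_projection:
  assumes "selfadjoint_on P T" shows "inner (P x) x = (norm (P x))\<^sup>2"
  using is_adjoint_inner[OF selfadjoint_onD(1)[OF assms], of "P x" x]
  by (simp add: selfadjoint_onD[OF assms] dot_square_norm)

lemma scalar_op_of_real: "scalar_op (of_real r) o\<^sub>L P = r *\<^sub>R P"
  by (rule blinfun_eqI) (simp add: scalar_op.rep_eq scaleC_of_real blinfun.scaleR_left)

lemma spectrum_on_between:
  assumes T: "selfadjoint_on P T" and bet: "form_between P T lo hi"
    and r: "complex_of_real r \<in> spectrum_on P T"
  shows "lo \<le> r" "r \<le> hi"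
proof -
  have ninv: "\<not> invertible_on P (T - r *\<^sub>R P)"
    using r by (simp add: spectrum_on_def scalar_op_of_real)
  have sa: "selfadjoint_on P (T - r *\<^sub>R P)" "selfadjoint_on P (r *\<^sub>R P - T)"
    by (intro selfadjoint_on_diff selfadjoint_on_scaleR T selfadjoint_on_self[OF T])+
  show "lo \<le> r"
  proof (rule ccontr)
    assume "\<not> lo \<le> r"
    then have "invertible_on P (T - r *\<^sub>R P)"
      using bet by (intro coercive_invertible_on[OF sa(1), of "lo - r"])
        (auto simp: form_between_def blinfun.diff_left blinfun.scaleR_left inner_diff_left
          inner_projection[OF T] left_diff_distrib)
    with ninv show False ..
  qed
  show "r \<le> hi"
  proof (rule ccontr)
    assume "\<not> r \<le> hi"
    then have "invertible_on P (r *\<^sub>R P - T)"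
      using bet by (intro coercive_invertible_on[OF sa(2), of "r - hi"])
        (auto simp: form_between_def blinfun.diff_left blinfun.scaleR_left inner_diff_left
          inner_projection[OF T] left_diff_distrib)
    then show False
      using ninv invertible_on_minus[of P "T - r *\<^sub>R P"] by simp
  qed
qed

lemma form_between_norm:
  assumes T: "selfadjoint_on P T"
  shows "form_between P T (- norm T) (norm T)"
  unfolding form_between_def
proof
  fix x
  have "inner (T x) x = inner (T (P x)) (P x)"
    using is_adjoint_inner[OF selfadjoint_onD(1)[OF T], of "T x" x] by (simp add: selfadjoint_onD[OF T])
  also have "\<bar>\<dots>\<bar> \<le> norm (T (P x)) * norm (P x)"
    by (rule Cauchy_Schwarz_ineq2)
  also have "\<dots> \<le> norm T * norm (P x) * norm (P x)"
    by (intro mult_right_mono norm_blinfun) auto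
  finally show "- norm T * (norm (P x))\<^sup>2 \<le> inner (T x) x \<and> inner (T x) x \<le> norm T * (norm (P x))\<^sup>2"
    by (simp add: power2_eq_square abs_le_iff)
qed

lemma poly_on_linear:
  assumes "selfadjoint_on P T"
  shows "poly_on P [:c, d:] T = c *\<^sub>R P + d *\<^sub>R T"
  by (rule blinfun_eqI) (simp add: poly_on_apply map_poly_pCons ceval_pCons selfadjoint_onD[OF assms]
      scaleC_of_real blinfun.add_left blinfun.scaleR_left blinfun.scaleR_right)

text \<open>
  The bounds come from the norm of \<open>c + T\<close> and \<open>c - T\<close>. For \<open>c = \<parallel>T\<parallel>\<close> both operators are
  positive, so their norms are attained at the largest and at the smallest spectral value of \<open>T\<close>.
\<close>

lemma spectrum_on_extreme:
  assumes T: "selfadjoint_on P T" and "P \<noteq> 0"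
  obtains lo hi where "form_between P T lo hi"
    "complex_of_real lo \<in> spectrum_on P T" "complex_of_real hi \<in> spectrum_on P T"
proof -
  define c where "c = norm T"
  have bound: "\<bar>\<alpha>\<bar> \<le> c" if "complex_of_real \<alpha> \<in> spectrum_on P T" for \<alpha>
    using spectrum_on_between[OF T form_between_norm[OF T] that] by (simp add: c_def)
  have le: "inner (S x) x \<le> norm S * (norm (P x))\<^sup>2" if "selfadjoint_on P S" for S x
    using form_between_norm[OF that] by (simp add: form_between_def)
  obtain hi where hi: "complex_of_real hi \<in> spectrum_on P T"
      "\<bar>poly [:c, 1:] hi\<bar> = norm (poly_on P [:c, 1:] T)"
    using norm_poly_on_attained[OF assms] .
  obtain lo where lo: "complex_of_real lo \<in> spectrum_on P T"
      "\<bar>poly [:c, -1:] lo\<bar> = norm (poly_on P [:c, -1:] T)"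
    using norm_poly_on_attained[OF assms] .
  have "inner (T x) x \<le> hi * (norm (P x))\<^sup>2" for x
  proof -
    have n: "norm (poly_on P [:c, 1:] T) = c + hi"
      using hi(2) bound[OF hi(1)] by simp
    show ?thesis
      using le[OF selfadjoint_on_poly_on[OF T, of "[:c, 1:]"], of x, unfolded n]
      by (simp add: poly_on_linear[OF T] blinfun.add_left blinfun.scaleR_left inner_add_left
        inner_projection[OF T] algebra_simps)
  qed
  moreover have "lo * (norm (P x))\<^sup>2 \<le> inner (T x) x" for x
  proof -
    have n: "norm (poly_on P [:c, -1:] T) = c - lo"
      using lo(2) bound[OF lo(1)] by simp
    show ?thesis
      using le[OF selfadjoint_on_poly_on[OF T, of "[:c, -1:]"], of x, unfolded n]
      by (simp add: poly_on_linear[OF T] blinfun.add_left blinfun.diff_left blinfun.scaleR_left inner_add_left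
        inner_diff_left inner_projection[OF T] algebra_simps)
  qed
  ultimately show ?thesis
    by (intro that[OF _ lo(1) hi(1)]) (simp add: form_between_def)
qed

section \<open>Continuous functional calculus\<close>

lemma poly_on_pCons:
  assumes "selfadjoint_on P T"
  shows "poly_on P (pCons a p) T = a *\<^sub>R P + (T o\<^sub>L poly_on P p T)"
proof (rule blinfun_eqI)
  fix x
  have "map_poly complex_of_real (pCons a p) = pCons (of_real a) (map_poly of_real p)"
    by (simp add: map_poly_pCons)
  then show "poly_on P (pCons a p) T x = (a *\<^sub>R P + (T o\<^sub>L poly_on P p T)) x"
    by (simp add: poly_on_apply ceval_pCons[OF selfadjoint_onD(2)[OF assms]] scaleC_of_real
      blinfun.add_left blinfun.scaleR_left)
qed

lemma poly_on_0 [simp]: "poly_on P 0 T = 0"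
  by (simp add: poly_on_def)

lemma poly_on_add: "poly_on P (p + q) T = poly_on P p T + poly_on P q T"
proof -
  have "map_poly complex_of_real (p + q) = map_poly of_real p + map_poly of_real q"
    by (rule poly_eqI) (simp add: coeff_map_poly)
  then show ?thesis
    by (intro blinfun_eqI) (simp add: poly_on_apply ceval_add blinfun.add_left)
qed

lemma poly_on_smult: "poly_on P (smult c p) T = c *\<^sub>R poly_on P p T"
proof -
  have "map_poly complex_of_real (smult c p) = smult (of_real c) (map_poly of_real p)"
    by (rule poly_eqI) (simp add: coeff_map_poly)
  then show ?thesis
    by (intro blinfun_eqI) (simp add: poly_on_apply ceval_smult blinfun.scaleR_left scaleC_of_real)
qed

lemma poly_on_diff: "poly_on P (p - q) T = poly_on P p T - poly_on P q T"
  using poly_on_add[of P p "smult (-1) q" T] poly_on_smult[of P "-1" q T] by simp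

lemma poly_on_mult:
  assumes "selfadjoint_on P T"
  shows "poly_on P (p * q) T = poly_on P p T o\<^sub>L poly_on P q T"
proof (induction p)
  case (pCons a p)
  have "P (poly_on P q T x) = poly_on P q T x" for x
    by (rule selfadjoint_onD(4)[OF selfadjoint_on_poly_on[OF assms]])
  then show ?case
    by (intro blinfun_eqI) (simp add: poly_on_pCons[OF assms] poly_on_add poly_on_smult pCons.IH
      blinfun.add_left blinfun.scaleR_left)
qed (simp add: blinfun_eqI)

lemma poly_on_pcompose:
  assumes "selfadjoint_on P T"
  shows "poly_on P (pcompose p q) T = poly_on P p (poly_on P q T)"
proof (induction p)
  case (pCons a p)
  have "poly_on P [:a:] T = a *\<^sub>R P"
    using poly_on_linear[OF assms, of a 0] by simp
  then show ?case
    by (simp add: pcompose_pCons poly_on_add poly_on_mult[OF assms] pCons.IH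
      poly_on_pCons[OF selfadjoint_on_poly_on[OF assms]])
qed simp

lemma norm_poly_on_le:
  assumes T: "selfadjoint_on P T" and "e \<ge> 0"
    and le: "\<And>t. complex_of_real t \<in> spectrum_on P T \<Longrightarrow> \<bar>poly p t\<bar> \<le> e"
  shows "norm (poly_on P p T) \<le> e"
proof (cases "P = 0")
  case True
  have "poly_on P p T x = 0" for x
    using selfadjoint_onD(4)[OF selfadjoint_on_poly_on[OF T], of p x] True by simp
  then show ?thesis
    using \<open>e \<ge> 0\<close> by (intro norm_blinfun_bound) auto
next
  case False
  then show ?thesis
    using norm_poly_on_attained[OF T False, of p] le by metis
qed

lemma weierstrass_real:
  fixes g :: "real \<Rightarrow> real"
  assumes "continuous_on {lo..hi} g"
  obtains p where "uniform_limit {lo..hi} (\<lambda>n. poly (p n)) g sequentially"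
proof -
  have "\<exists>p. \<forall>t\<in>{lo..hi}. \<bar>g t - poly p t\<bar> < inverse (Suc n)" for n
  proof -
    obtain f where f: "real_polynomial_function f" "\<And>t. t \<in> {lo..hi} \<Longrightarrow> \<bar>g t - f t\<bar> < inverse (Suc n)"
      using Stone_Weierstrass_real_polynomial_function[OF compact_Icc assms, of "inverse (Suc n)"]
      by auto
    then obtain a m where a: "f = (\<lambda>x. \<Sum>i\<le>m. a i * x ^ i)"
      unfolding real_polynomial_function_iff_sum by blast
    have "poly (\<Sum>i\<le>m. monom (a i) i) t = f t" for t
      by (simp add: a poly_sum poly_monom)
    then show ?thesis
      using f(2) by metis
  qed
  then obtain p where p: "\<And>n t. t \<in> {lo..hi} \<Longrightarrow> \<bar>g t - poly (p n) t\<bar> < inverse (Suc n)"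
    by metis
  have "uniform_limit {lo..hi} (\<lambda>n. poly (p n)) g sequentially"
  proof (rule uniform_limitI)
    fix e :: real assume "e > 0"
    then obtain N where N: "inverse (Suc N) < e"
      using reals_Archimedean by blast
    have "dist (poly (p n) t) (g t) < e" if "n \<ge> N" "t \<in> {lo..hi}" for n t
    proof -
      have "inverse (real (Suc n)) \<le> inverse (Suc N)"
        using that(1) by simp
      then show ?thesis
        using p[OF that(2), of n] N unfolding dist_real_def by linarith
    qed
    then show "\<forall>\<^sub>F n in sequentially. \<forall>t\<in>{lo..hi}. dist (poly (p n) t) (g t) < e"
      unfolding eventually_sequentially by blast
  qed
  then show ?thesis
    by (rule that)
qed

lemma poly_on_dist_eventually:
  assumes T: "selfadjoint_on P T" and "e > 0"
    and p: "uniform_limit {t. complex_of_real t \<in> spectrum_on P T} (\<lambda>n. poly (p n)) g sequentially"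
    and q: "uniform_limit {t. complex_of_real t \<in> spectrum_on P T} (\<lambda>n. poly (q n)) g sequentially"
  shows "\<exists>N. \<forall>m\<ge>N. \<forall>n\<ge>N. dist (poly_on P (p m) T) (poly_on P (q n) T) \<le> e"
proof -
  have "e / 2 > 0"
    using \<open>e > 0\<close> by simp
  then obtain M N where
    M: "\<And>n t. n \<ge> M \<Longrightarrow> complex_of_real t \<in> spectrum_on P T \<Longrightarrow> dist (poly (p n) t) (g t) < e / 2" and
    N: "\<And>n t. n \<ge> N \<Longrightarrow> complex_of_real t \<in> spectrum_on P T \<Longrightarrow> dist (poly (q n) t) (g t) < e / 2"
    using p q unfolding uniform_limit_iff eventually_sequentially by (metis mem_Collect_eq)
  have "norm (poly_on P (p m - q n) T) \<le> e" if "m \<ge> max M N" "n \<ge> max M N" for m n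
  proof (rule norm_poly_on_le[OF T])
    fix t assume t: "complex_of_real t \<in> spectrum_on P T"
    show "\<bar>poly (p m - q n) t\<bar> \<le> e"
      using M[of m t] N[of n t] t that unfolding dist_real_def poly_diff by simp argo
  qed (use \<open>e > 0\<close> in simp)
  then show ?thesis
    by (intro exI[of _ "max M N"]) (simp add: poly_on_diff dist_norm)
qed

text \<open>
  Since \<open>\<parallel>p(T)\<parallel>\<close> is at most the supremum of \<open>\<bar>p\<bar>\<close> over the spectrum, polynomials converging uniformly
  there give a Cauchy sequence of operators whose limit depends on the limit function only. It is enough to
  have uniform convergence on an interval that contains the spectrum.
\<close>

lemma cfc_on_limit:
  assumes T: "selfadjoint_on P T" and bet: "form_between P T lo hi"
    and p: "uniform_limit {lo..hi} (\<lambda>n. poly (p n)) g sequentially"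
  shows "(\<lambda>n. poly_on P (p n) T) \<longlonglongrightarrow> cfc_on P g T"
proof -
  define X where "X = {t. complex_of_real t \<in> spectrum_on P T}"
  have "X \<subseteq> {lo..hi}"
    using spectrum_on_between[OF T bet] by (auto simp: X_def)
  then have pX: "uniform_limit X (\<lambda>n. poly (p n)) g sequentially"
    by (rule uniform_limit_on_subset[OF p])
  have "Cauchy (\<lambda>n. poly_on P (p n) T)"
  proof (rule metric_CauchyI)
    fix e :: real assume "e > 0"
    then show "\<exists>M. \<forall>m\<ge>M. \<forall>n\<ge>M. dist (poly_on P (p m) T) (poly_on P (p n) T) < e"
      using poly_on_dist_eventually[OF T half_gt_zero[OF \<open>e > 0\<close>] pX[unfolded X_def] pX[unfolded X_def]]
      by (metis field_sum_of_halves half_gt_zero less_add_same_cancel1 order_le_less_trans)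
  qed
  then obtain L where L: "(\<lambda>n. poly_on P (p n) T) \<longlonglongrightarrow> L"
    using Cauchy_convergent_iff convergent_def by blast
  have all: "(\<lambda>n. poly_on P (q n) T) \<longlonglongrightarrow> L"
    if q: "uniform_limit X (\<lambda>n. poly (q n)) g sequentially" for q
  proof -
    have "(\<lambda>n. poly_on P (p n) T - poly_on P (q n) T) \<longlonglongrightarrow> 0"
    proof (rule LIMSEQ_I)
      fix e :: real assume "e > 0"
      then show "\<exists>N. \<forall>n\<ge>N. norm (poly_on P (p n) T - poly_on P (q n) T - 0) < e"
        using poly_on_dist_eventually[OF T half_gt_zero[OF \<open>e > 0\<close>] pX[unfolded X_def] q[unfolded X_def]]
        by (metis dist_norm diff_zero field_sum_of_halves half_gt_zero less_add_same_cancel1 order_le_less_trans)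
    qed
    from tendsto_diff[OF L this] show ?thesis
      by simp
  qed
  have "cfc_on P g T = L"
    unfolding cfc_on_def
  proof (rule the_equality)
    show "\<forall>q. uniform_limit {t. complex_of_real t \<in> spectrum_on P T} (\<lambda>n. poly (q n)) g sequentially
        \<longrightarrow> (\<lambda>n. poly_on P (q n) T) \<longlonglongrightarrow> L"
      using all unfolding X_def by blast
    show "L' = L" if "\<forall>q. uniform_limit {t. complex_of_real t \<in> spectrum_on P T} (\<lambda>n. poly (q n)) g sequentially
        \<longrightarrow> (\<lambda>n. poly_on P (q n) T) \<longlonglongrightarrow> L'" for L'
      using that pX L LIMSEQ_unique unfolding X_def by blast
  qed
  with L show ?thesis
    by simp
qed

lemma selfadjoint_on_cfc:
  assumes T: "selfadjoint_on P T" and bet: "form_between P T lo hi"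
    and g: "continuous_on {lo..hi} g"
  shows "selfadjoint_on P (cfc_on P g T)"
proof -
  obtain p where "uniform_limit {lo..hi} (\<lambda>n. poly (p n)) g sequentially"
    using weierstrass_real[OF g] .
  note lim = cfc_on_limit[OF T bet this]
  show ?thesis
  proof (rule selfadjoint_onI)
    show "is_adjoint (cfc_on P g T) (cfc_on P g T)"
      by (rule is_adjoint_limit[OF _ lim lim]) (rule selfadjoint_onD(2)[OF selfadjoint_on_poly_on[OF T]])
    show "P o\<^sub>L cfc_on P g T = cfc_on P g T"
    proof (rule blinfun_eqI)
      fix x
      have "(\<lambda>n. P (poly_on P (p n) T x)) \<longlonglongrightarrow> P (cfc_on P g T x)"
        by (intro blinfun.tendsto lim tendsto_const)
      moreover have "(\<lambda>n. P (poly_on P (p n) T x)) \<longlonglongrightarrow> cfc_on P g T x"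
        by (simp add: selfadjoint_onD(4)[OF selfadjoint_on_poly_on[OF T]])
          (intro blinfun.tendsto lim tendsto_const)
      ultimately show "(P o\<^sub>L cfc_on P g T) x = cfc_on P g T x"
        by (simp add: LIMSEQ_unique)
    qed
    show "P o\<^sub>L P = P"
      using T by (simp add: selfadjoint_on_def orth_projection_def)
  qed (use T in \<open>rule selfadjoint_onD\<close>)
qed

lemma cfc_on_approx:
  assumes T: "selfadjoint_on P T" and bet: "form_between P T lo hi"
    and g: "continuous_on {lo..hi} g" and "e \<ge> 0"
    and p: "\<And>t. t \<in> {lo..hi} \<Longrightarrow> \<bar>poly p t - g t\<bar> \<le> e"
  shows "norm (poly_on P p T - cfc_on P g T) \<le> e"
proof (rule field_le_epsilon)
  fix d :: real assume "d > 0"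
  obtain q where q: "uniform_limit {lo..hi} (\<lambda>n. poly (q n)) g sequentially"
    using weierstrass_real[OF g] .
  have "\<forall>\<^sub>F n in sequentially. norm (poly_on P p T - poly_on P (q n) T) \<le> e + d"
    using uniform_limitD[OF q \<open>d > 0\<close>]
  proof eventually_elim
    case (elim n)
    have "\<bar>poly (p - q n) t\<bar> \<le> e + d" if "complex_of_real t \<in> spectrum_on P T" for t
    proof -
      have "t \<in> {lo..hi}"
        using spectrum_on_between[OF T bet that] by simp
      then show ?thesis
        using p[of t] elim by (fastforce simp: dist_real_def)
    qed
    then show ?case
      using norm_poly_on_le[OF T, of "e + d" "p - q n"] \<open>e \<ge> 0\<close> \<open>d > 0\<close> by (simp add: poly_on_diff)
  qed
  moreover have "(\<lambda>n. norm (poly_on P p T - poly_on P (q n) T)) \<longlonglongrightarrow> norm (poly_on P p T - cfc_on P g T)"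
    by (intro tendsto_intros cfc_on_limit[OF T bet q])
  ultimately show "norm (poly_on P p T - cfc_on P g T) \<le> e + d"
    by (intro tendsto_upperbound) auto
qed

text \<open>
  The function \<open>g\<close> stays within the distance \<open>(v - u) / 2\<close> of the constant \<open>(u + v) / 2\<close>; hence so does
  \<open>g(T)\<close> in norm.
\<close>

lemma form_between_cfc:
  assumes T: "selfadjoint_on P T" and bet: "form_between P T lo hi"
    and g: "continuous_on {lo..hi} g" and "u \<le> v"
    and uv: "\<And>t. t \<in> {lo..hi} \<Longrightarrow> u \<le> g t \<and> g t \<le> v"
  shows "form_between P (cfc_on P g T) u v"
proof -
  define c r where "c = (u + v) / 2" and "r = (v - u) / 2"
  define D where "D = c *\<^sub>R P - cfc_on P g T"
  have D: "selfadjoint_on P D"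
    unfolding D_def
    by (intro selfadjoint_on_diff selfadjoint_on_scaleR selfadjoint_on_self[OF T]
        selfadjoint_on_cfc[OF T bet g])
  have "\<bar>poly [:c:] t - g t\<bar> \<le> r" if "t \<in> {lo..hi}" for t
    using uv[OF that] unfolding c_def r_def by (simp add: abs_le_iff) argo
  then have "norm D \<le> r"
    using cfc_on_approx[OF T bet g, of r "[:c:]"] \<open>u \<le> v\<close> poly_on_linear[OF T, of c 0]
    by (simp add: D_def r_def)
  show ?thesis
    unfolding form_between_def
  proof
    fix x
    have "\<bar>inner (D x) x\<bar> \<le> norm D * (norm (P x))\<^sup>2"
      using form_between_norm[OF D] unfolding form_between_def by (simp add: abs_le_iff) (metis minus_le_iff)
    also have "\<dots> \<le> r * (norm (P x))\<^sup>2"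
      using \<open>norm D \<le> r\<close> by (rule mult_right_mono) simp
    finally have "\<bar>c * (norm (P x))\<^sup>2 - inner (cfc_on P g T x) x\<bar> \<le> r * (norm (P x))\<^sup>2"
      by (simp add: D_def blinfun.diff_left blinfun.scaleR_left inner_diff_left inner_projection[OF T])
    moreover have "u * (norm (P x))\<^sup>2 = c * (norm (P x))\<^sup>2 - r * (norm (P x))\<^sup>2"
      "v * (norm (P x))\<^sup>2 = c * (norm (P x))\<^sup>2 + r * (norm (P x))\<^sup>2"
      by (simp_all add: c_def r_def field_simps)
    ultimately show "u * (norm (P x))\<^sup>2 \<le> inner (cfc_on P g T x) x \<and>
        inner (cfc_on P g T x) x \<le> v * (norm (P x))\<^sup>2"
      by linarith
  qed
qed

lemma cfc_on_diff:
  assumes T: "selfadjoint_on P T" and bet: "form_between P T lo hi"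
    and g: "continuous_on {lo..hi} g" and h: "continuous_on {lo..hi} h"
  shows "cfc_on P (\<lambda>t. g t - h t) T = cfc_on P g T - cfc_on P h T"
proof -
  obtain p q where p: "uniform_limit {lo..hi} (\<lambda>n. poly (p n)) g sequentially"
    and q: "uniform_limit {lo..hi} (\<lambda>n. poly (q n)) h sequentially"
    using weierstrass_real[OF g] weierstrass_real[OF h] by metis
  have "uniform_limit {lo..hi} (\<lambda>n. poly (p n - q n)) (\<lambda>t. g t - h t) sequentially"
    unfolding poly_diff by (rule uniform_limit_minus[OF p q])
  from cfc_on_limit[OF T bet this] have "(\<lambda>n. poly_on P (p n) T - poly_on P (q n) T)
      \<longlonglongrightarrow> cfc_on P (\<lambda>t. g t - h t) T"
    by (simp add: poly_on_diff)
  then show ?thesis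
    using tendsto_diff[OF cfc_on_limit[OF T bet p] cfc_on_limit[OF T bet q]]
    by (rule LIMSEQ_unique)
qed

lemma cfc_on_shift:
  assumes T: "selfadjoint_on P T" and bet: "form_between P T lo hi"
    and g: "continuous_on {lo - m..hi - m} g"
  shows "cfc_on P g (T - m *\<^sub>R P) = cfc_on P (\<lambda>t. g (t - m)) T"
proof -
  define S where "S = T - m *\<^sub>R P"
  have S: "selfadjoint_on P S"
    unfolding S_def by (intro selfadjoint_on_diff selfadjoint_on_scaleR T selfadjoint_on_self[OF T])
  have betS: "form_between P S (lo - m) (hi - m)"
    using bet unfolding form_between_def S_def
    by (simp add: blinfun.diff_left blinfun.scaleR_left inner_diff_left inner_projection[OF T]
        left_diff_distrib)
  obtain p where p: "uniform_limit {lo - m..hi - m} (\<lambda>n. poly (p n)) g sequentially"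
    using weierstrass_real[OF g] .
  have "uniform_limit {lo..hi} (\<lambda>n. poly (pcompose (p n) [:-m, 1:])) (\<lambda>t. g (t - m)) sequentially"
    unfolding uniform_limit_iff
  proof (intro allI impI)
    fix e :: real assume "e > 0"
    from uniform_limitD[OF p this]
    show "\<forall>\<^sub>F n in sequentially. \<forall>t\<in>{lo..hi}. dist (poly (pcompose (p n) [:- m, 1:]) t) (g (t - m)) < e"
      by eventually_elim (auto simp: poly_pcompose algebra_simps)
  qed
  from cfc_on_limit[OF T bet this] have "(\<lambda>n. poly_on P (p n) S) \<longlonglongrightarrow> cfc_on P (\<lambda>t. g (t - m)) T"
    using poly_on_linear[OF T, of "-m" 1] by (simp add: poly_on_pcompose[OF T] S_def)
  then show ?thesis
    using cfc_on_limit[OF S betS p] LIMSEQ_unique unfolding S_def by blast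
qed

section \<open>Transport to direct sums\<close>

text \<open>
  For partial isometries \<open>J1\<close>, \<open>J2\<close> with orthogonal ranges and adjoints \<open>K1\<close>, \<open>K2\<close>, the operator
  \<open>J1 T1 K1 + J2 T2 K2\<close> is a copy of the direct sum \<open>T1 \<oplus> T2\<close>, living in another space.
\<close>

lemma poly_on_block:
  assumes T1: "selfadjoint_on P1 T1" and T2: "selfadjoint_on P2 T2"
    and adj: "is_adjoint J1 K1" "is_adjoint J2 K2"
    and KJ: "K1 o\<^sub>L J1 = P1" "K2 o\<^sub>L J2 = P2" "K1 o\<^sub>L J2 = 0" "K2 o\<^sub>L J1 = 0"
    and PK: "P1 o\<^sub>L K1 = K1" "P2 o\<^sub>L K2 = K2"
  shows "selfadjoint_on ((J1 o\<^sub>L K1) + (J2 o\<^sub>L K2)) ((J1 o\<^sub>L T1 o\<^sub>L K1) + (J2 o\<^sub>L T2 o\<^sub>L K2))" (is "selfadjoint_on ?Q ?T")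
    and "poly_on ((J1 o\<^sub>L K1) + (J2 o\<^sub>L K2)) p ((J1 o\<^sub>L T1 o\<^sub>L K1) + (J2 o\<^sub>L T2 o\<^sub>L K2)) =
      (J1 o\<^sub>L poly_on P1 p T1 o\<^sub>L K1) + (J2 o\<^sub>L poly_on P2 p T2 o\<^sub>L K2)"
    and "form_between P1 T1 lo hi \<Longrightarrow> form_between P2 T2 lo hi \<Longrightarrow>
      form_between ((J1 o\<^sub>L K1) + (J2 o\<^sub>L K2)) ((J1 o\<^sub>L T1 o\<^sub>L K1) + (J2 o\<^sub>L T2 o\<^sub>L K2)) lo hi"
proof -
  have KJ': "K1 (J1 x) = P1 x" "K2 (J2 x') = P2 x'" "K1 (J2 x') = 0" "K2 (J1 x) = 0" for x x'
    using KJ by (metis blinfun_apply_blinfun_compose zero_blinfun.rep_eq)+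
  have PK': "P1 (K1 z) = K1 z" "P2 (K2 z) = K2 z" for z
    using PK by (metis blinfun_apply_blinfun_compose)+
  note adj' = is_adjoint_sym[OF adj(1)] is_adjoint_sym[OF adj(2)]
  show sa: "selfadjoint_on ?Q ?T"
  proof (rule selfadjoint_onI)
    show "is_adjoint ?Q ?Q"
      by (intro is_adjoint_add is_adjoint_compose adj adj')
    show "is_adjoint ?T ?T"
      using is_adjoint_compose[OF adj(1) is_adjoint_compose[OF selfadjoint_onD(2)[OF T1] adj'(1)]]
        is_adjoint_compose[OF adj(2) is_adjoint_compose[OF selfadjoint_onD(2)[OF T2] adj'(2)]]
      by (simp add: is_adjoint_add blinfun_compose_assoc)
    show "?Q o\<^sub>L ?Q = ?Q" "?Q o\<^sub>L ?T = ?T"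
      by (auto intro!: blinfun_eqI simp: blinfun.add_left blinfun.add_right KJ' PK'
          selfadjoint_onD[OF T1] selfadjoint_onD[OF T2])
  qed
  show "poly_on ?Q p ?T = (J1 o\<^sub>L poly_on P1 p T1 o\<^sub>L K1) + (J2 o\<^sub>L poly_on P2 p T2 o\<^sub>L K2)"
  proof (induction p)
    case (pCons a p)
    have "P1 (poly_on P1 p T1 z) = poly_on P1 p T1 z" "P2 (poly_on P2 p T2 z') = poly_on P2 p T2 z'" for z z'
      by (intro selfadjoint_onD(4)[OF selfadjoint_on_poly_on] T1 T2)+
    then show ?case
      by (intro blinfun_eqI)
        (simp add: poly_on_pCons[OF sa] poly_on_pCons[OF T1] poly_on_pCons[OF T2] pCons.IH
          blinfun.add_left blinfun.add_right blinfun.scaleR_left blinfun.scaleR_right KJ' PK' scaleR_add_right)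
  qed (simp add: blinfun_eqI)
  show "form_between ?Q ?T lo hi" if "form_between P1 T1 lo hi" "form_between P2 T2 lo hi"
    unfolding form_between_def
  proof
    fix z
    have n: "(norm (?Q z))\<^sup>2 = (norm (K1 z))\<^sup>2 + (norm (K2 z))\<^sup>2"
      unfolding inner_projection[OF sa, symmetric]
      by (simp add: blinfun.add_left inner_add_left is_adjoint_inner[OF adj(1)]
          is_adjoint_inner[OF adj(2)] dot_square_norm)
    have t: "inner (?T z) z = inner (T1 (K1 z)) (K1 z) + inner (T2 (K2 z)) (K2 z)"
      by (simp add: blinfun.add_left inner_add_left is_adjoint_inner[OF adj(1)]
          is_adjoint_inner[OF adj(2)])
    show "lo * (norm (?Q z))\<^sup>2 \<le> inner (?T z) z \<and> inner (?T z) z \<le> hi * (norm (?Q z))\<^sup>2"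
      using that unfolding form_between_def n t
      by (metis PK' add_mono distrib_left)
  qed
qed

lemma cfc_on_block:
  assumes T1: "selfadjoint_on P1 T1" and T2: "selfadjoint_on P2 T2"
    and adj: "is_adjoint J1 K1" "is_adjoint J2 K2"
    and KJ: "K1 o\<^sub>L J1 = P1" "K2 o\<^sub>L J2 = P2" "K1 o\<^sub>L J2 = 0" "K2 o\<^sub>L J1 = 0"
    and PK: "P1 o\<^sub>L K1 = K1" "P2 o\<^sub>L K2 = K2"
    and bet: "form_between P1 T1 lo hi" "form_between P2 T2 lo hi"
    and g: "continuous_on {lo..hi} g"
  shows "cfc_on ((J1 o\<^sub>L K1) + (J2 o\<^sub>L K2)) g ((J1 o\<^sub>L T1 o\<^sub>L K1) + (J2 o\<^sub>L T2 o\<^sub>L K2)) =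
      (J1 o\<^sub>L cfc_on P1 g T1 o\<^sub>L K1) + (J2 o\<^sub>L cfc_on P2 g T2 o\<^sub>L K2)"
proof -
  note block = poly_on_block[OF T1 T2 adj KJ PK]
  obtain p where p: "uniform_limit {lo..hi} (\<lambda>n. poly (p n)) g sequentially"
    using weierstrass_real[OF g] .
  have "(\<lambda>n. (J1 o\<^sub>L poly_on P1 (p n) T1 o\<^sub>L K1) + (J2 o\<^sub>L poly_on P2 (p n) T2 o\<^sub>L K2))
      \<longlonglongrightarrow> (J1 o\<^sub>L cfc_on P1 g T1 o\<^sub>L K1) + (J2 o\<^sub>L cfc_on P2 g T2 o\<^sub>L K2)"
    by (intro tendsto_add bounded_bilinear.tendsto[OF bounded_bilinear_blinfun_compose] tendsto_const
        cfc_on_limit[OF T1 bet(1) p] cfc_on_limit[OF T2 bet(2) p])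
  then show ?thesis
    using cfc_on_limit[OF block(1) block(3)[OF bet] p] LIMSEQ_unique
    unfolding block(2) by blast
qed

lemma cfc_on_isometry:
  assumes T: "selfadjoint_on P T" and adj: "is_adjoint J K"
    and KJ: "K o\<^sub>L J = P" and PK: "P o\<^sub>L K = K"
    and bet: "form_between P T lo hi" and g: "continuous_on {lo..hi} g"
  shows "cfc_on (J o\<^sub>L K) g (J o\<^sub>L T o\<^sub>L K) = J o\<^sub>L cfc_on P g T o\<^sub>L K"
proof -
  have z: "selfadjoint_on (0 :: 'a \<Rightarrow>\<^sub>L 'a) 0"
    by (intro selfadjoint_onI is_adjoint_0) (auto intro!: blinfun_eqI)
  have "form_between (0 :: 'a \<Rightarrow>\<^sub>L 'a) 0 lo hi"
    by (simp add: form_between_def)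
  from cfc_on_block[OF T z adj is_adjoint_0 KJ _ _ _ PK _ bet this g] show ?thesis
    by (simp add: zero_blinfun.rep_eq blinfun_eqI)
qed

section \<open>Finite orthonormal families\<close>

lift_definition rank1 :: "'k::complex_hilbert \<Rightarrow> 'h::complex_hilbert \<Rightarrow> 'h \<Rightarrow>\<^sub>L 'k"
  is "\<lambda>f e x. scaleC (cinner x e) f"
proof (rule bounded_linear_intro)
  fix f :: 'k and e x y :: 'h and r :: real
  show "scaleC (cinner (x + y) e) f = scaleC (cinner x e) f + scaleC (cinner y e) f"
    by (simp add: cinner_add_left scaleC_add_left)
  show "scaleC (cinner (r *\<^sub>R x) e) f = r *\<^sub>R scaleC (cinner x e) f"
    by (simp add: cinner_scaleR_left scaleR_scaleC)
  show "norm (scaleC (cinner x e) f) \<le> norm x * (2 * norm e * norm f)"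
    using mult_right_mono[OF cmod_cinner_le[of x e], of "norm f"]
    by (simp add: norm_scaleC algebra_simps)
qed

lemma is_adjoint_rank1: "is_adjoint (rank1 f e) (rank1 e f)"
  unfolding is_adjoint_def rank1.rep_eq cinner_scaleC_left cinner_scaleC_right
  by (metis cinner_commute mult.commute)

text \<open>
  For orthonormal families this is the partial isometry taking \<open>e i\<close> to \<open>f i\<close> for \<open>i < n\<close> and vanishing on the
  orthogonal complement of the \<open>e i\<close>; in particular \<open>partial_iso e e n\<close> is the projection onto their
  complex span.
\<close>

definition partial_iso ::
  "(nat \<Rightarrow> 'k::complex_hilbert) \<Rightarrow> (nat \<Rightarrow> 'h::complex_hilbert) \<Rightarrow> nat \<Rightarrow> 'h \<Rightarrow>\<^sub>L 'k" where
  "partial_iso f e n = (\<Sum>i<n. rank1 (f i) (e i))"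

lemma partial_iso_apply: "partial_iso f e n x = (\<Sum>i<n. scaleC (cinner x (e i)) (f i))"
  by (simp add: partial_iso_def blinfun.sum_left rank1.rep_eq)

lemma is_adjoint_partial_iso: "is_adjoint (partial_iso f e n) (partial_iso e f n)"
  unfolding partial_iso_def by (intro is_adjoint_sum is_adjoint_rank1)

definition orthonormal :: "(nat \<Rightarrow> 'h::complex_hilbert) \<Rightarrow> nat \<Rightarrow> bool" where
  "orthonormal e n \<longleftrightarrow> (\<forall>i<n. \<forall>j<n. cinner (e i) (e j) = (if i = j then 1 else 0))"

lemma partial_iso_compose:
  assumes "orthonormal f n"
  shows "partial_iso g f n o\<^sub>L partial_iso f e n = partial_iso g e n"
proof (rule blinfun_eqI)
  fix x
  have "cinner (partial_iso f e n x) (f i) = cinner x (e i)" if "i < n" for i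
  proof -
    have "cinner (partial_iso f e n x) (f i) = (\<Sum>j<n. if j = i then cinner x (e j) else 0)"
      unfolding partial_iso_apply cinner_sum_left
      by (rule sum.cong) (use assms that in \<open>auto simp: cinner_scaleC_left orthonormal_def\<close>)
    then show ?thesis
      using that by simp
  qed
  then show "(partial_iso g f n o\<^sub>L partial_iso f e n) x = partial_iso g e n x"
    by (simp add: partial_iso_apply[of g])
qed

lemma partial_iso_compose_zero:
  assumes "\<And>i j. i < n \<Longrightarrow> j < n \<Longrightarrow> cinner (f i) (f' j) = 0"
  shows "partial_iso g f' n o\<^sub>L partial_iso f e n = 0"
  by (rule blinfun_eqI)
    (simp add: partial_iso_apply cinner_sum_left cinner_scaleC_left assms)

lemma selfadjoint_on_finite_rank:
  assumes "orthonormal e n"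
  shows "selfadjoint_on (partial_iso e e n) (partial_iso e e n)"
  by (intro selfadjoint_onI is_adjoint_partial_iso partial_iso_compose assms)

text \<open>
  The Gram-Schmidt step: \<open>u\<close> is the normalised component of \<open>v\<close> orthogonal to the family.
\<close>

lemma orthonormal_extend:
  assumes e: "orthonormal e n" and v: "partial_iso e e n v \<noteq> v"
  obtains u where "orthonormal (e(n := u)) (Suc n)"
    "partial_iso (e(n := u)) (e(n := u)) (Suc n) = partial_iso e e n + rank1 u u"
    "v = partial_iso e e n v + scaleC (cinner v u) u"
proof -
  define P where "P = partial_iso e e n"
  have P: "selfadjoint_on P P"
    unfolding P_def by (rule selfadjoint_on_finite_rank[OF e])
  define w where "w = v - P v"
  define r where "r = norm w"
  have "r > 0"
    using v by (simp add: r_def w_def P_def)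
  define u where "u = (1 / r) *\<^sub>R w"
  have Pe: "P (e i) = e i" if "i < n" for i
  proof -
    have "P (e i) = (\<Sum>j<n. if j = i then e j else 0)"
      unfolding P_def partial_iso_apply
      by (rule sum.cong) (use e that in \<open>auto simp: orthonormal_def\<close>)
    then show ?thesis
      using that by simp
  qed
  have "P w = 0"
    by (simp add: w_def blinfun.diff_right selfadjoint_onD[OF P])
  then have "cinner w (e i) = 0" if "i < n" for i
    using is_adjointD[OF selfadjoint_onD(1)[OF P], of w "e i"] Pe[OF that] by simp
  then have ue: "cinner u (e i) = 0" "cinner (e i) u = 0" if "i < n" for i
    using that cinner_commute[of "e i" w] by (simp_all add: u_def cinner_scaleR_left cinner_scaleR_right)
  have uu: "cinner u u = 1"
    using \<open>r > 0\<close> by (simp add: cinner_self u_def r_def)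
  have "cinner v u = cinner w u + cinner (P v) u"
    by (simp add: w_def cinner_diff_left)
  also have "cinner (P v) u = 0"
    using is_adjointD[OF selfadjoint_onD(1)[OF P], of v u] \<open>P w = 0\<close>
    by (simp add: u_def blinfun.scaleR_right)
  also have "cinner w u = of_real r"
    using \<open>r > 0\<close> by (simp add: u_def cinner_scaleR_right cinner_self r_def power2_eq_square)
  finally have "scaleC (cinner v u) u = w"
    using \<open>r > 0\<close> by (simp add: scaleC_of_real u_def)
  then have "v = P v + scaleC (cinner v u) u"
    by (simp add: w_def)
  moreover have "orthonormal (e(n := u)) (Suc n)"
    using e ue uu by (auto simp: orthonormal_def less_Suc_eq)
  moreover have "partial_iso (e(n := u)) (e(n := u)) (Suc n) = P + rank1 u u"
    by (simp add: P_def partial_iso_def)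
  ultimately show ?thesis
    unfolding P_def by (intro that)
qed

lemma orthonormal_containing:
  assumes "finite (X :: 'h::complex_hilbert set)"
  shows "\<exists>e n. orthonormal e n \<and> (\<forall>x\<in>X. partial_iso e e n x = x)"
  using assms
proof (induction X)
  case empty
  then show ?case
    by (intro exI[of _ "\<lambda>_. 0"] exI[of _ 0]) (simp add: orthonormal_def)
next
  case (insert v X)
  then obtain e n where e: "orthonormal e n" "\<And>x. x \<in> X \<Longrightarrow> partial_iso e e n x = x"
    by blast
  show ?case
  proof (cases "partial_iso e e n v = v")
    case True
    then show ?thesis
      using e by blast
  next
    case False
    obtain u where u: "orthonormal (e(n := u)) (Suc n)"
      "partial_iso (e(n := u)) (e(n := u)) (Suc n) = partial_iso e e n + rank1 u u"
      "v = partial_iso e e n v + scaleC (cinner v u) u"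
      using orthonormal_extend[OF e(1) False] .
    have "cinner x u = 0" if "x \<in> X" for x
    proof -
      have "cinner (e i) u = 0" if "i < n" for i
      proof -
        have "cinner ((e(n := u)) i) ((e(n := u)) n) = 0"
          using u(1) that unfolding orthonormal_def
          by (metis lessI less_SucI less_irrefl)
        then show ?thesis
          using that by simp
      qed
      then have "cinner (partial_iso e e n x) u = 0"
        by (simp add: partial_iso_apply cinner_sum_left cinner_scaleC_left)
      then show ?thesis
        using e(2)[OF that] by simp
    qed
    then have "\<forall>x\<in>insert v X. partial_iso (e(n := u)) (e(n := u)) (Suc n) x = x"
      unfolding u(2) using e(2) u(3) by (auto simp: blinfun.add_left rank1.rep_eq)
    with u(1) show ?thesis
      by blast
  qed
qed

text \<open>
  A maximal orthonormal family \<open>f\<close> of \<open>n\<close> vectors would span the space. As \<^term>\<open>span\<close> is the real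
  span, the finite spanning set consists of the \<open>f i\<close> and the \<open>\<i> f i\<close>.
\<close>

lemma orthonormal_infinite_dim:
  assumes infinite_dim: "\<not> (\<exists>S :: 'u::complex_hilbert set. finite S \<and> span S = UNIV)"
  shows "\<exists>f :: nat \<Rightarrow> 'u. orthonormal f n"
proof (induction n)
  case 0
  then show ?case
    by (simp add: orthonormal_def)
next
  case (Suc n)
  then obtain f :: "nat \<Rightarrow> 'u" where f: "orthonormal f n"
    by blast
  show ?case
  proof (cases "\<exists>v. partial_iso f f n v \<noteq> v")
    case True
    then show ?thesis
      using orthonormal_extend[OF f] by metis
  next
    case False
    define S where "S = f ` {..<n} \<union> (\<lambda>i. scaleC \<i> (f i)) ` {..<n}"
    have "v \<in> span S" for v
    proof -
      have "scaleC c (f i) \<in> span S" if "i < n" for c i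
      proof -
        have "c = of_real (Re c) + \<i> * of_real (Im c)"
          by (simp add: complex_eq)
        then have "scaleC c (f i) = Re c *\<^sub>R f i + Im c *\<^sub>R scaleC \<i> (f i)"
          by (metis mult.commute scaleC_add_left scaleC_of_real scaleC_scaleC)
        also have "\<dots> \<in> span S"
          by (intro span_add span_scale span_base) (use that in \<open>auto simp: S_def\<close>)
        finally show ?thesis .
      qed
      then have "partial_iso f f n v \<in> span S"
        unfolding partial_iso_apply by (intro span_sum) simp
      then show ?thesis
        using False by simp
    qed
    moreover have "finite S"
      by (simp add: S_def)
    ultimately show ?thesis
      using infinite_dim by blast
  qed
qed

section \<open>Strong operator convexity implies operator monotonicity\<close>

lemma SOC_continuous_on:
  assumes "g \<in> SOC TYPE('u::complex_hilbert) {..<b}" "hi < b"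
  shows "continuous_on {lo..hi} g"
  using assms by (auto simp: SOC_def intro: continuous_on_subset)

lemma SOC_compression:
  fixes Q :: "'u::complex_hilbert \<Rightarrow>\<^sub>L 'u"
  assumes soc: "g \<in> SOC TYPE('u) {..<b}"
    and A: "selfadjoint_on Q A" "form_between Q A lo hi" "hi < b"
    and R: "selfadjoint_on R R" "R o\<^sub>L Q = R"
  shows "inner (cfc_on R g (R o\<^sub>L A o\<^sub>L R) z) z \<le> inner (cfc_on Q g A z) z"
proof -
  have "spectrum_on Q A \<subseteq> complex_of_real ` {..<b}"
  proof
    fix w assume w: "w \<in> spectrum_on Q A"
    then have eq: "w = of_real (Re w)"
      using spectrum_on_real[OF A(1)] by (simp add: complex_eq_iff)
    then have "Re w \<le> hi"
      using spectrum_on_between(2)[OF A(1,2)] w by metis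
    then show "w \<in> complex_of_real ` {..<b}"
      using eq A(3) by auto
  qed
  then have "op_le (cfc_on R g (R o\<^sub>L A o\<^sub>L R)) (cfc_on Q g A)"
    using soc A(1) R unfolding SOC_def selfadjoint_on_def by blast
  then show ?thesis
    by (rule op_leD)
qed

text \<open>
  The compression inequality applied to a copy of \<open>A \<oplus> D\<close> inside \<open>'u\<close> and to the range of the
  isometry \<open>V : v \<mapsto> (\<surd>t v, \<surd>(1 - t) v)\<close>. Since \<open>V\<^sup>* (A \<oplus> D) V = t A + (1 - t) D\<close>, it says
  that \<open>V g(t A + (1 - t) D) V\<^sup>* \<le> g(A) \<oplus> g(D)\<close>, which is evaluated at \<open>(x, y)\<close>. The finite rank of
  \<open>P\<close> allows two orthogonal copies of its range to be placed in \<open>'u\<close>, whatever the space of \<open>A\<close> and \<open>D\<close> is.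
\<close>

lemma SOC_two_block:
  fixes e :: "nat \<Rightarrow> 'h::complex_hilbert"
  assumes infinite_dim: "\<not> (\<exists>S :: 'u::complex_hilbert set. finite S \<and> span S = UNIV)"
    and soc: "g \<in> SOC TYPE('u) {..<b}"
    and e: "orthonormal e n" and P_def: "P = partial_iso e e n"
    and A: "selfadjoint_on P A" "form_between P A lo hi"
    and D: "selfadjoint_on P D" "form_between P D lo hi"
    and "hi < b" and t: "0 \<le> t" "t \<le> 1"
    and w: "w = sqrt t *\<^sub>R x + sqrt (1 - t) *\<^sub>R y"
  shows "inner (cfc_on P g (t *\<^sub>R A + (1 - t) *\<^sub>R D) w) w
    \<le> inner (cfc_on P g A x) x + inner (cfc_on P g D y) y"
proof -
  obtain f :: "nat \<Rightarrow> 'u" where f: "orthonormal f (n + n)"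
    using orthonormal_infinite_dim[OF infinite_dim] by blast
  define f1 f2 where "f1 = f" and "f2 = (\<lambda>i. f (n + i))"
  have f12: "orthonormal f1 n" "orthonormal f2 n"
    using f by (auto simp: orthonormal_def f1_def f2_def)
  have f0: "cinner (f1 i) (f2 j) = 0" "cinner (f2 i) (f1 j) = 0" if "i < n" "j < n" for i j
    using f that by (auto simp: orthonormal_def f1_def f2_def)
  define J1 K1 J2 K2 where "J1 = partial_iso f1 e n" and "K1 = partial_iso e f1 n"
    and "J2 = partial_iso f2 e n" and "K2 = partial_iso e f2 n"
  note JK_defs = J1_def K1_def J2_def K2_def
  have adj: "is_adjoint J1 K1" "is_adjoint J2 K2"
    unfolding JK_defs by (rule is_adjoint_partial_iso)+
  have KJ: "K1 o\<^sub>L J1 = P" "K2 o\<^sub>L J2 = P" "K1 o\<^sub>L J2 = 0" "K2 o\<^sub>L J1 = 0"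
    unfolding JK_defs P_def by (intro partial_iso_compose partial_iso_compose_zero f12 f0; assumption)+
  have PK: "P o\<^sub>L K1 = K1" "P o\<^sub>L K2 = K2" and JP: "J1 o\<^sub>L P = J1" "J2 o\<^sub>L P = J2"
    unfolding JK_defs P_def by (intro partial_iso_compose e)+
  have KJ': "K1 (J1 v) = P v" "K2 (J2 v) = P v" "K1 (J2 v) = 0" "K2 (J1 v) = 0" for v
    using KJ by (metis blinfun_apply_blinfun_compose zero_blinfun.rep_eq)+
  have PK': "P (K1 z) = K1 z" "P (K2 z) = K2 z" for z
    using PK by (metis blinfun_apply_blinfun_compose)+
  have JP': "J1 (P v) = J1 v" "J2 (P v) = J2 v" for v
    using JP by (metis blinfun_apply_blinfun_compose)+
  note A_simps = selfadjoint_onD[OF A(1)] and D_simps = selfadjoint_onD[OF D(1)]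
  define a c where "a = sqrt t" and "c = sqrt (1 - t)"
  have ac: "a * a = t" "c * c = 1 - t"
    using t by (simp_all add: a_def c_def)
  define V W where "V = a *\<^sub>R J1 + c *\<^sub>R J2" and "W = a *\<^sub>R K1 + c *\<^sub>R K2"
  have V: "V v = a *\<^sub>R J1 v + c *\<^sub>R J2 v" and W: "W z = a *\<^sub>R K1 z + c *\<^sub>R K2 z" for v z
    by (simp_all add: V_def W_def blinfun.add_left blinfun.scaleR_left)
  have VW: "is_adjoint V W"
    unfolding V_def W_def by (intro is_adjoint_add is_adjoint_scaleR adj)
  have WV: "W (V v) = P v" for v
  proof -
    have "W (V v) = (a * a + c * c) *\<^sub>R P v"
      by (simp add: V W blinfun.add_right blinfun.scaleR_right KJ' scaleR_add_left)
    then show ?thesis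
      by (simp add: ac)
  qed
  have PW: "P (W z) = W z" for z
    by (simp add: W blinfun.add_right blinfun.scaleR_right PK')
  define C where "C = t *\<^sub>R A + (1 - t) *\<^sub>R D"
  have C: "selfadjoint_on P C"
    unfolding C_def by (intro selfadjoint_on_add selfadjoint_on_scaleR A D)
  have betC: "form_between P C lo hi"
    unfolding form_between_def
  proof
    fix v
    have C_v: "inner (C v) v = t * inner (A v) v + (1 - t) * inner (D v) v"
      by (simp add: C_def blinfun.add_left blinfun.scaleR_left inner_add_left)
    have split: "r = t * r + (1 - t) * r" for r :: real
      by (simp add: algebra_simps)
    show "lo * (norm (P v))\<^sup>2 \<le> inner (C v) v \<and> inner (C v) v \<le> hi * (norm (P v))\<^sup>2"
      unfolding C_v using A(2) D(2) t unfolding form_between_def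
      by (subst split[of "lo * (norm (P v))\<^sup>2"], subst split[of "hi * (norm (P v))\<^sup>2"])
        (intro conjI add_mono mult_left_mono; simp)
  qed
  define Q A' R where "Q = (J1 o\<^sub>L K1) + (J2 o\<^sub>L K2)"
    and "A' = (J1 o\<^sub>L A o\<^sub>L K1) + (J2 o\<^sub>L D o\<^sub>L K2)" and "R = V o\<^sub>L W"
  note block = poly_on_block[OF A(1) D(1) adj KJ PK, folded Q_def A'_def]
  have Q: "selfadjoint_on Q A'" "form_between Q A' lo hi"
    using block(1) block(3)[OF A(2) D(2)] .
  have R: "selfadjoint_on R R"
  proof (rule selfadjoint_onI)
    show "is_adjoint R R"
      unfolding R_def by (intro is_adjoint_compose VW is_adjoint_sym[OF VW])
    then show "is_adjoint R R" .
    show "R o\<^sub>L R = R"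
      by (rule blinfun_eqI) (simp add: R_def WV PW)
    then show "R o\<^sub>L R = R" .
  qed
  have RQ: "R o\<^sub>L Q = R"
    by (rule blinfun_eqI)
      (simp add: R_def Q_def W blinfun.add_left blinfun.add_right KJ' PK')
  have RAR: "R o\<^sub>L A' o\<^sub>L R = V o\<^sub>L C o\<^sub>L W"
  proof (rule blinfun_eqI)
    fix z
    have "W (A' (V v)) = (a * a) *\<^sub>R A v + (c * c) *\<^sub>R D v" for v
      by (simp add: A'_def V W blinfun.add_left blinfun.add_right blinfun.scaleR_right KJ'
          A_simps D_simps)
    then have "W (A' (V v)) = C v" for v
      by (simp add: C_def blinfun.add_left blinfun.scaleR_left ac)
    then show "(R o\<^sub>L A' o\<^sub>L R) z = (V o\<^sub>L C o\<^sub>L W) z"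
      by (simp add: R_def)
  qed
  note g = SOC_continuous_on[OF soc \<open>hi < b\<close>, of lo]
  have "cfc_on R g (R o\<^sub>L A' o\<^sub>L R) = V o\<^sub>L cfc_on P g C o\<^sub>L W"
    unfolding RAR unfolding R_def
  proof (rule cfc_on_isometry[OF C VW _ _ betC g])
    show "W o\<^sub>L V = P"
      by (rule blinfun_eqI) (simp add: WV)
    show "P o\<^sub>L W = W"
      by (rule blinfun_eqI) (simp add: PW)
  qed
  moreover have "cfc_on Q g A' = (J1 o\<^sub>L cfc_on P g A o\<^sub>L K1) + (J2 o\<^sub>L cfc_on P g D o\<^sub>L K2)"
    unfolding Q_def A'_def by (rule cfc_on_block[OF A(1) D(1) adj KJ PK A(2) D(2) g])
  moreover have "inner (cfc_on R g (R o\<^sub>L A' o\<^sub>L R) z) z \<le> inner (cfc_on Q g A' z) z" for z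
    by (rule SOC_compression[OF soc Q \<open>hi < b\<close> R RQ])
  ultimately have main: "inner (cfc_on P g C (W z)) (W z) \<le>
      inner (cfc_on P g A (K1 z)) (K1 z) + inner (cfc_on P g D (K2 z)) (K2 z)" for z
    by (simp add: blinfun.add_left inner_add_left is_adjoint_inner[OF VW] is_adjoint_inner[OF adj(1)]
        is_adjoint_inner[OF adj(2)])
  define z where "z = J1 x + J2 y"
  have z: "K1 z = P x" "K2 z = P y" "W z = P w"
    by (simp_all add: z_def w W a_def c_def blinfun.add_right blinfun.scaleR_right KJ')
  have drop: "inner (cfc_on P g S (P v)) (P v) = inner (cfc_on P g S v) v"
    if "selfadjoint_on P S" "form_between P S lo hi" for S v
  proof -
    note G = selfadjoint_onD[OF selfadjoint_on_cfc[OF that g]]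
    show ?thesis
      using is_adjoint_inner[OF G(1), of "cfc_on P g S v" v] by (simp add: G)
  qed
  show ?thesis
    using main[of z] unfolding z drop[OF A] drop[OF D] drop[OF C betC] unfolding C_def .
qed

text \<open>
  With \<open>y = 0\<close> the two-block inequality becomes \<open>t g(t A + (1 - t) D) \<le> g(A)\<close>. Here \<open>D\<close> is
  chosen such that \<open>t A + (1 - t) D = B\<close>. Then \<open>D \<le> A\<close>, so \<open>D\<close> is admissible precisely because the interval
  has no lower end. Letting \<open>t \<rightarrow> 1\<close> gives \<open>g(B) \<le> g(A)\<close>.
\<close>

lemma SOC_monotone_finite_rank:
  fixes e :: "nat \<Rightarrow> 'h::complex_hilbert"
  assumes infinite_dim: "\<not> (\<exists>S :: 'u::complex_hilbert set. finite S \<and> span S = UNIV)"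
    and soc: "g \<in> SOC TYPE('u) {..<b}"
    and e: "orthonormal e n" and P_def: "P = partial_iso e e n"
    and A: "selfadjoint_on P A" "form_between P A lo hi"
    and B: "selfadjoint_on P B" "form_between P B lo hi"
    and "hi < b" and le: "\<And>x. inner (B x) x \<le> inner (A x) x"
  shows "inner (cfc_on P g B x) x \<le> inner (cfc_on P g A x) x"
proof (rule field_le_mult_one_interval)
  fix t :: real assume t: "0 < t" "t < 1"
  define D where "D = (1 / (1 - t)) *\<^sub>R (B - t *\<^sub>R A)"
  have D: "selfadjoint_on P D"
    unfolding D_def by (intro selfadjoint_on_scaleR selfadjoint_on_diff A B)
  \<comment> \<open>\<open>D\<close> need not satisfy the lower bound of \<open>A\<close> and \<open>B\<close>, and it may drift to \<open>-\<infinity>\<close> as \<open>t \<rightarrow> 1\<close>.\<close>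
  define lo' where "lo' = min lo (- norm D)"
  have lo': "lo' * (norm (P v))\<^sup>2 \<le> lo * (norm (P v))\<^sup>2"
    "lo' * (norm (P v))\<^sup>2 \<le> - norm D * (norm (P v))\<^sup>2" for v
    by (intro mult_right_mono; simp add: lo'_def)+
  have betA: "form_between P A lo' hi"
    using A(2) lo'(1) unfolding form_between_def by (meson order_trans)
  have "inner (D v) v \<le> hi * (norm (P v))\<^sup>2" for v
  proof -
    have "(1 - t) * inner (D v) v = inner (B v) v - t * inner (A v) v"
      using t by (simp add: D_def blinfun.scaleR_left blinfun.diff_left inner_diff_left)
    also have "\<dots> \<le> (1 - t) * inner (A v) v"
      using le[of v] by (simp add: algebra_simps)
    finally have "inner (D v) v \<le> inner (A v) v"
      using t by simp
    then show ?thesis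
      using A(2) unfolding form_between_def by (meson order_trans)
  qed
  then have betD: "form_between P D lo' hi"
    using form_between_norm[OF D] lo'(2) unfolding form_between_def by (meson order_trans)
  have st: "sqrt t * (sqrt t * r) = t * r" for r
    using t by (simp add: mult.assoc[symmetric])
  have "t *\<^sub>R A + (1 - t) *\<^sub>R D = B"
    using t by (simp add: D_def)
  then have "inner (cfc_on P g B (sqrt t *\<^sub>R x)) (sqrt t *\<^sub>R x) \<le> inner (cfc_on P g A x) x"
    using SOC_two_block[OF infinite_dim soc e P_def A(1) betA D betD \<open>hi < b\<close>, of t "sqrt t *\<^sub>R x" x 0] t
    by simp
  then show "t * inner (cfc_on P g B x) x \<le> inner (cfc_on P g A x) x"
    by (simp add: blinfun.scaleR_right st)
qed

section \<open>Passage to arbitrary Hilbert spaces\<close>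

lemma poly_on_compress:
  assumes P: "selfadjoint_on P P"
    and invar: "\<And>i. i \<le> degree p \<Longrightarrow> P ((blinfun_apply T ^^ i) x) = (blinfun_apply T ^^ i) x"
  shows "poly_on P p (P o\<^sub>L T o\<^sub>L P) x = poly_on id_blinfun p T x"
proof -
  have "pow_on P (P o\<^sub>L T o\<^sub>L P) i x = (blinfun_apply T ^^ i) x" if "i \<le> degree p" for i
    using that
  proof (induction i)
    case 0
    then show ?case
      using invar[of 0] by simp
  next
    case (Suc i)
    then show ?case
      using invar[of i] invar[of "Suc i"] by simp
  qed
  then show ?thesis
    by (simp add: poly_on_def blinfun.sum_left blinfun.scaleR_left pow_on_apply[of id_blinfun])
qed

lemma selfadjoint_on_compress:
  assumes P: "selfadjoint_on P P" and T: "selfadjoint T"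
  shows "selfadjoint_on P (P o\<^sub>L T o\<^sub>L P)"
proof (rule selfadjoint_onI)
  have "is_adjoint T T"
    using T by (simp add: selfadjoint_iff)
  from is_adjoint_compose[OF is_adjoint_compose[OF selfadjoint_onD(1)[OF P] this] selfadjoint_onD(1)[OF P]]
  show "is_adjoint (P o\<^sub>L T o\<^sub>L P) (P o\<^sub>L T o\<^sub>L P)"
    by (simp add: blinfun_compose_assoc)
qed (auto intro!: blinfun_eqI simp: selfadjoint_onD[OF P])

lemma form_between_compress:
  assumes P: "selfadjoint_on P P" and bet: "form_between id_blinfun T lo hi"
  shows "form_between P (P o\<^sub>L T o\<^sub>L P) lo hi"
  using bet is_adjoint_inner[OF selfadjoint_onD(1)[OF P]] by (simp add: form_between_def)

text \<open>
  For a fixed vector \<open>x\<close> and a polynomial \<open>p\<close> close to \<open>g\<close>, the vectors \<open>p(A)x\<close> and \<open>p(B)x\<close> do not change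
  when \<open>A\<close> and \<open>B\<close> are compressed to the finite-dimensional span of the vectors \<open>A\<^sup>i x\<close> and \<open>B\<^sup>i x\<close>,
  \<open>i \<le> degree p\<close>. The form bounds survive the compression, so \<open>p\<close> is equally close to \<open>g\<close> for the
  compressed operators.
\<close>

theorem SOC_operator_monotone:
  fixes A B :: "'h::complex_hilbert \<Rightarrow>\<^sub>L 'h"
  assumes infinite_dim: "\<not> (\<exists>S :: 'u::complex_hilbert set. finite S \<and> span S = UNIV)"
    and soc: "g \<in> SOC TYPE('u) {..<b}"
    and A: "selfadjoint A" "form_between id_blinfun A lo hi"
    and B: "selfadjoint B" "form_between id_blinfun B lo hi"
    and "hi < b" and le: "\<And>x. inner (B x) x \<le> inner (A x) x"
  shows "inner (cfc g B x) x \<le> inner (cfc g A x) x"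
proof (rule field_le_epsilon)
  fix \<epsilon> :: real assume "\<epsilon> > 0"
  \<comment> \<open>Four replacements of \<open>g\<close> by \<open>p\<close> or back, each at a cost of at most \<open>\<eta> \<parallel>x\<parallel>\<^sup>2\<close>; the
    summand \<open>1\<close> avoids division by zero for \<open>x = 0\<close>.\<close>
  define K where "K = (norm x)\<^sup>2 + 1"
  define \<eta> where "\<eta> = \<epsilon> / (4 * K)"
  have "K > 0"
    by (simp add: K_def add_nonneg_pos)
  then have "\<eta> > 0" "4 * (\<eta> * K) = \<epsilon>"
    using \<open>\<epsilon> > 0\<close> by (simp_all add: \<eta>_def)
  then have \<eta>: "4 * (\<eta> * (norm x)\<^sup>2) \<le> \<epsilon>"
    by (simp add: K_def distrib_left)
  note g = SOC_continuous_on[OF soc \<open>hi < b\<close>, of lo]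
  obtain q where q: "uniform_limit {lo..hi} (\<lambda>n. poly (q n)) g sequentially"
    using weierstrass_real[OF g] .
  obtain n where n: "\<forall>t\<in>{lo..hi}. dist (poly (q n) t) (g t) < \<eta>"
    using eventually_happens'[OF sequentially_bot uniform_limitD[OF q \<open>\<eta> > 0\<close>]] by blast
  define p where "p = q n"
  have p: "\<bar>poly p t - g t\<bar> \<le> \<eta>" if "t \<in> {lo..hi}" for t
    using n that by (simp add: p_def dist_real_def less_imp_le)
  define X where "X = (\<lambda>i. (blinfun_apply A ^^ i) x) ` {..degree p} \<union>
    (\<lambda>i. (blinfun_apply B ^^ i) x) ` {..degree p}"
  have "finite X"
    by (simp add: X_def)
  then obtain e :: "nat \<Rightarrow> 'h" and k where e: "orthonormal e k" "\<And>v. v \<in> X \<Longrightarrow> partial_iso e e k v = v"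
    using orthonormal_containing by blast
  define P where "P = partial_iso e e k"
  have P: "selfadjoint_on P P"
    unfolding P_def by (rule selfadjoint_on_finite_rank[OF e(1)])
  have fix_A: "P ((blinfun_apply A ^^ i) x) = (blinfun_apply A ^^ i) x"
    and fix_B: "P ((blinfun_apply B ^^ i) x) = (blinfun_apply B ^^ i) x" if "i \<le> degree p" for i
    using that by (auto simp: P_def X_def intro!: e(2))
  have Px: "P x = x"
    using fix_A[of 0] by simp
  have approx: "\<bar>inner (poly_on R p T x) x - inner (cfc_on R g T x) x\<bar> \<le> \<eta> * (norm x)\<^sup>2"
    if "selfadjoint_on R T" "form_between R T lo hi" for R T :: "'h \<Rightarrow>\<^sub>L 'h"
  proof -
    define E where "E = poly_on R p T - cfc_on R g T"
    have "norm E \<le> \<eta>"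
      unfolding E_def using cfc_on_approx[OF that g] p \<open>\<eta> > 0\<close> by simp
    have "\<bar>inner (E x) x\<bar> \<le> norm (E x) * norm x"
      by (rule Cauchy_Schwarz_ineq2)
    also have "\<dots> \<le> (norm E * norm x) * norm x"
      by (intro mult_right_mono norm_blinfun) simp
    also have "\<dots> \<le> \<eta> * (norm x)\<^sup>2"
      using \<open>norm E \<le> \<eta>\<close> by (simp add: power2_eq_square mult.assoc mult_right_mono)
    finally show ?thesis
      by (simp add: E_def blinfun.diff_left inner_diff_left)
  qed
  define A' B' where "A' = P o\<^sub>L A o\<^sub>L P" and "B' = P o\<^sub>L B o\<^sub>L P"
  have A': "selfadjoint_on P A'" "form_between P A' lo hi"
    and B': "selfadjoint_on P B'" "form_between P B' lo hi"
    unfolding A'_def B'_def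
    by (intro selfadjoint_on_compress form_between_compress P A B)+
  have "inner (B' v) v \<le> inner (A' v) v" for v
    using le[of "P v"] is_adjoint_inner[OF selfadjoint_onD(1)[OF P]] by (simp add: A'_def B'_def)
  then have "inner (cfc_on P g B' x) x \<le> inner (cfc_on P g A' x) x"
    by (rule SOC_monotone_finite_rank[OF infinite_dim soc e(1) P_def A' B' \<open>hi < b\<close>])
  moreover have "poly_on P p A' x = poly_on id_blinfun p A x"
    "poly_on P p B' x = poly_on id_blinfun p B x"
    unfolding A'_def B'_def by (intro poly_on_compress P fix_A fix_B; assumption)+
  moreover have "\<bar>inner (poly_on id_blinfun p A x) x - inner (cfc g A x) x\<bar> \<le> \<eta> * (norm x)\<^sup>2"
    "\<bar>inner (poly_on id_blinfun p B x) x - inner (cfc g B x) x\<bar> \<le> \<eta> * (norm x)\<^sup>2"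
    by (intro approx A(2) B(2); simp add: selfadjoint_on_id A(1) B(1))+
  ultimately show "inner (cfc g B x) x \<le> inner (cfc g A x) x + \<epsilon>"
    using approx[OF A'] approx[OF B'] \<eta> by (simp only: abs_le_iff) (elim conjE, linarith)
qed

section \<open>Monotonicity and convexity of the scalar function\<close>

lemma cfc_on_two_values:
  assumes q: "selfadjoint_on P q" and qq: "q o\<^sub>L q = q"
    and st: "s \<in> {lo..hi}" "t \<in> {lo..hi}" and g: "continuous_on {lo..hi} g"
  shows "selfadjoint_on P (s *\<^sub>R (P - q) + t *\<^sub>R q)"
    and "form_between P (s *\<^sub>R (P - q) + t *\<^sub>R q) lo hi"
    and "cfc_on P g (s *\<^sub>R (P - q) + t *\<^sub>R q) = g s *\<^sub>R (P - q) + g t *\<^sub>R q"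
proof -
  define T where "T = s *\<^sub>R (P - q) + t *\<^sub>R q"
  note q_simps = selfadjoint_onD[OF q]
  have qq': "q (q x) = q x" for x
    using qq by (metis blinfun_apply_blinfun_compose)
  show sa: "selfadjoint_on P T"
    unfolding T_def by (intro selfadjoint_on_add selfadjoint_on_scaleR selfadjoint_on_diff q selfadjoint_on_self[OF q])
  show bet: "form_between P T lo hi"
    unfolding form_between_def
  proof
    fix x
    define u v where "u = (norm (P x))\<^sup>2 - (norm (q x))\<^sup>2" and "v = (norm (q x))\<^sup>2"
    have qx: "inner (q x) x = v"
      using is_adjoint_inner[OF q_simps(2), of "q x" x] by (simp add: qq' v_def dot_square_norm)
    have "selfadjoint_on q q"
      by (intro selfadjoint_onI q_simps qq)
    then have "norm (q (P x)) \<le> norm (P x)"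
      by (rule norm_projection_le)
    then have "0 \<le> u"
      by (simp add: u_def q_simps power_mono)
    moreover have "0 \<le> v"
      by (simp add: v_def)
    moreover have "inner (T x) x = s * u + t * v"
      by (simp add: T_def blinfun.add_left blinfun.scaleR_left blinfun.diff_left inner_add_left
          inner_diff_left inner_projection[OF q] qx u_def v_def)
    moreover have "lo * (norm (P x))\<^sup>2 = lo * u + lo * v" "hi * (norm (P x))\<^sup>2 = hi * u + hi * v"
      by (simp_all add: u_def v_def algebra_simps)
    ultimately show "lo * (norm (P x))\<^sup>2 \<le> inner (T x) x \<and> inner (T x) x \<le> hi * (norm (P x))\<^sup>2"
      using st by (auto intro!: add_mono mult_right_mono)
  qed
  have poly: "poly_on P p T = poly p s *\<^sub>R (P - q) + poly p t *\<^sub>R q" for p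
  proof (induction p)
    case (pCons a p)
    show ?case
      unfolding poly_on_pCons[OF sa] pCons.IH
      by (rule blinfun_eqI) (simp add: T_def blinfun.add_left blinfun.add_right blinfun.diff_left
          blinfun.diff_right blinfun.scaleR_left blinfun.scaleR_right q_simps qq' algebra_simps)
  qed simp
  obtain p where p: "uniform_limit {lo..hi} (\<lambda>n. poly (p n)) g sequentially"
    using weierstrass_real[OF g] .
  have "(\<lambda>n. poly (p n) s *\<^sub>R (P - q) + poly (p n) t *\<^sub>R q) \<longlonglongrightarrow> g s *\<^sub>R (P - q) + g t *\<^sub>R q"
    by (intro tendsto_intros tendsto_uniform_limitI[OF p] st)
  then show "cfc_on P g T = g s *\<^sub>R (P - q) + g t *\<^sub>R q"
    using cfc_on_limit[OF sa bet p] LIMSEQ_unique unfolding poly by blast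
qed

lemma cfc_on_scalar:
  assumes P: "selfadjoint_on P P" and s: "s \<in> {lo..hi}" and g: "continuous_on {lo..hi} g"
  shows "selfadjoint_on P (s *\<^sub>R P)" "form_between P (s *\<^sub>R P) lo hi"
    and "cfc_on P g (s *\<^sub>R P) = g s *\<^sub>R P"
proof -
  have PP: "P o\<^sub>L P = P"
    by (rule blinfun_eqI) (simp add: selfadjoint_onD[OF P])
  show "selfadjoint_on P (s *\<^sub>R P)" "form_between P (s *\<^sub>R P) lo hi"
    "cfc_on P g (s *\<^sub>R P) = g s *\<^sub>R P"
    using cfc_on_two_values[OF P PP s s g] by simp_all
qed

text \<open>
  Both properties come from multiples of a projection of rank one: monotonicity from operator monotonicity,
  convexity from the two-block inequality at \<open>x = \<surd>t e\<close>, \<open>y = \<surd>(1 - t) e\<close>.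
\<close>

lemma SOC_scalar:
  assumes infinite_dim: "\<not> (\<exists>S :: 'u::complex_hilbert set. finite S \<and> span S = UNIV)"
    and soc: "g \<in> SOC TYPE('u) {..<b}"
  shows SOC_mono_on: "mono_on {..<b} g" and SOC_convex_on: "convex_on {..<b} g"
proof -
  obtain e :: "nat \<Rightarrow> 'u" where e: "orthonormal e 1"
    using orthonormal_infinite_dim[OF infinite_dim] by blast
  define P where "P = partial_iso e e 1"
  have P: "selfadjoint_on P P"
    unfolding P_def by (rule selfadjoint_on_finite_rank[OF e])
  have ee: "inner (e 0) (e 0) = 1"
    using e by (simp add: orthonormal_def Re_cinner[symmetric])
  have Pe: "P (e 0) = e 0"
    using e by (simp add: P_def partial_iso_apply orthonormal_def)
  show "mono_on {..<b} g"
  proof (rule mono_onI)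
    fix r s assume rs: "r \<in> {..<b}" "s \<in> {..<b}" "r \<le> s"
    have mem: "r \<in> {r..s}" "s \<in> {r..s}"
      using rs by auto
    note g = SOC_continuous_on[OF soc, of s r]
    have "inner (cfc_on P g (r *\<^sub>R P) (e 0)) (e 0) \<le> inner (cfc_on P g (s *\<^sub>R P) (e 0)) (e 0)"
      using rs by (intro SOC_monotone_finite_rank[OF infinite_dim soc e P_def, where lo = r and hi = s]
          cfc_on_scalar[OF P] mem g)
        (auto simp: blinfun.scaleR_left inner_projection[OF P] mult_right_mono)
    then show "g r \<le> g s"
      using rs by (simp add: cfc_on_scalar(3)[OF P mem(1) g] cfc_on_scalar(3)[OF P mem(2) g]
          blinfun.scaleR_left Pe ee)
  qed
  show "convex_on {..<b} g"
  proof (rule convex_onI)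
    show "convex {..<b}"
      by (rule convex_real_interval)
    fix t s r :: real assume t: "0 < t" "t < 1" and rs: "s \<in> {..<b}" "r \<in> {..<b}"
    define lo hi m where "lo = min r s" and "hi = max r s" and "m = t * r + (1 - t) * s"
    have "hi < b"
      using rs by (simp add: hi_def)
    note g = SOC_continuous_on[OF soc this, of lo]
    have mem: "r \<in> {lo..hi}" "s \<in> {lo..hi}"
      by (auto simp: lo_def hi_def)
    then have m: "m \<in> {lo..hi}"
      using t convexD_alt[OF convex_real_interval(5)[of lo hi], of s r t] by (simp add: m_def add.commute)
    have eq: "t *\<^sub>R (r *\<^sub>R P) + (1 - t) *\<^sub>R (s *\<^sub>R P) = m *\<^sub>R P"
      by (simp add: m_def scaleR_add_left)
    have w: "e 0 = sqrt t *\<^sub>R (sqrt t *\<^sub>R e 0) + sqrt (1 - t) *\<^sub>R (sqrt (1 - t) *\<^sub>R e 0)"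
      using t by (simp add: scaleR_add_left[symmetric])
    have sq: "sqrt t * (sqrt t * z) = t * z" "sqrt (1 - t) * (sqrt (1 - t) * z) = (1 - t) * z" for z
      using t by (simp_all add: mult.assoc[symmetric])
    have "g m \<le> t * g r + (1 - t) * g s"
      using SOC_two_block[OF infinite_dim soc e P_def cfc_on_scalar(1,2)[OF P mem(1) g]
          cfc_on_scalar(1,2)[OF P mem(2) g] \<open>hi < b\<close> _ _ w] t
      unfolding eq cfc_on_scalar(3)[OF P m g] cfc_on_scalar(3)[OF P mem(1) g] cfc_on_scalar(3)[OF P mem(2) g]
      by (simp add: blinfun.scaleR_left blinfun.scaleR_right Pe ee sq mult.left_commute mult.commute)
    then show "g ((1 - t) *\<^sub>R s + t *\<^sub>R r) \<le> (1 - t) * g s + t * g r"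
      by (simp add: m_def add.commute)
  qed
qed

section \<open>Strict monotonicity\<close>

lemma norm_cinner_orthonormal_pair_le:
  assumes "orthonormal e 2"
  shows "(cmod (cinner x (e 0)))\<^sup>2 + (cmod (cinner x (e 1)))\<^sup>2 \<le> (norm x)\<^sup>2"
proof -
  define P where "P = partial_iso e e 2"
  have P: "selfadjoint_on P P"
    unfolding P_def by (rule selfadjoint_on_finite_rank[OF assms])
  have "{..<2} = {0, 1 :: nat}"
    by auto
  then have "cinner (P x) x = cinner x (e 0) * cnj (cinner x (e 0)) + cinner x (e 1) * cnj (cinner x (e 1))"
    using cinner_commute[of "e 0" x] cinner_commute[of "e 1" x]
    by (simp add: P_def partial_iso_apply cinner_add_left cinner_scaleC_left)
  then have "cinner (P x) x = of_real ((cmod (cinner x (e 0)))\<^sup>2 + (cmod (cinner x (e 1)))\<^sup>2)"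
    unfolding complex_norm_square[symmetric] by simp
  then have "(cmod (cinner x (e 0)))\<^sup>2 + (cmod (cinner x (e 1)))\<^sup>2 = Re (cinner (P x) x)"
    by simp
  also have "\<dots> = (norm (P x))\<^sup>2"
    by (simp add: Re_cinner inner_projection[OF P])
  also have "\<dots> \<le> (norm x)\<^sup>2"
    by (intro power_mono norm_projection_le[OF P]) simp
  finally show ?thesis .
qed

lemma inner_rank1_self: "inner (rank1 u u x) x = (cmod (cinner x u))\<^sup>2"
proof -
  have "cinner (rank1 u u x) x = of_real ((cmod (cinner x u))\<^sup>2)"
    unfolding complex_norm_square using cinner_commute[of u x] by (simp add: rank1.rep_eq cinner_scaleC_left)
  then show ?thesis
    by (simp add: Re_cinner[symmetric] del: of_real_power)
qed

lemma selfadjoint_on_rank1: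
  assumes "cinner u u = 1"
  shows "selfadjoint_on id_blinfun (rank1 u u)" "rank1 u u o\<^sub>L rank1 u u = rank1 u u"
proof -
  show "selfadjoint_on id_blinfun (rank1 u u)"
    by (simp add: selfadjoint_on_id selfadjoint_iff is_adjoint_rank1)
  show "rank1 u u o\<^sub>L rank1 u u = rank1 u u"
    by (rule blinfun_eqI) (simp add: rank1.rep_eq cinner_scaleC_left assms)
qed

lemma weighted_Cauchy_Schwarz:
  fixes a k X Y v :: real
  assumes "v > 0"
  shows "(a * X + k * Y)\<^sup>2 \<le> (a\<^sup>2 + k\<^sup>2 / v) * (X\<^sup>2 + v * Y\<^sup>2)"
proof -
  have "(a\<^sup>2 + k\<^sup>2 / v) * (X\<^sup>2 + v * Y\<^sup>2) - (a * X + k * Y)\<^sup>2 = (a * v * Y - k * X)\<^sup>2 / v"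
    using assms by (simp add: field_simps power2_eq_square)
  also have "\<dots> \<ge> 0"
    using assms by simp
  finally show ?thesis
    by simp
qed

text \<open>
  Operator monotonicity for matrices of size two. Let \<open>A\<close> have the values \<open>s\<close> and \<open>r\<close> with \<open>r > t\<close>,
  the latter on the line through \<open>e 1\<close>, and let \<open>B\<close> have the values \<open>s - 1\<close> and \<open>t\<close>, the latter on the
  line through a slightly tilted vector \<open>f\<close>. If the tilt is small then \<open>B \<le> A\<close>. At \<open>e 0\<close> the operator \<open>g(A)\<close> has the
  value \<open>g s\<close>, while \<open>g(B)\<close> has a proper convex combination of \<open>g (s - 1) = g s\<close> and \<open>g t\<close>.
\<close>

lemma SOC_le_after_plateau:
  assumes infinite_dim: "\<not> (\<exists>S :: 'u::complex_hilbert set. finite S \<and> span S = UNIV)"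
    and soc: "g \<in> SOC TYPE('u) {..<b}"
    and "s < t" "t < b" and eq: "g (s - 1) = g s"
  shows "g t \<le> g s"
proof -
  obtain e :: "nat \<Rightarrow> 'u" where e: "orthonormal e 2"
    using orthonormal_infinite_dim[OF infinite_dim] by blast
  have ee: "cinner (e 0) (e 0) = 1" "cinner (e 1) (e 1) = 1" "cinner (e 0) (e 1) = 0" "cinner (e 1) (e 0) = 0"
    using e by (simp_all add: orthonormal_def)
  note ee = ee ee[unfolded One_nat_def]
  define r where "r = (t + b) / 2"
  have r: "t < r" "r < b"
    using \<open>t < b\<close> by (simp_all add: r_def)
  define u v where "u = t - s + 1" and "v = r - s + 1"
  have uv: "1 < u" "u < v"
    using \<open>s < t\<close> r by (simp_all add: u_def v_def)
  \<comment> \<open>The squared sine of the tilt. The comparison of \<open>B\<close> with \<open>A\<close> below needs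
    \<open>\<sigma> + (1 - \<sigma>) / v \<le> 1 / u\<close>.\<close>
  define \<sigma> where "\<sigma> = 1 / u - 1 / v"
  have \<sigma>: "0 < \<sigma>" "\<sigma> \<le> 1"
  proof -
    have "1 / v < 1 / u" "1 / u < 1" "0 < 1 / v"
      using uv by (simp_all add: field_simps)
    then show "0 < \<sigma>" "\<sigma> \<le> 1"
      unfolding \<sigma>_def by linarith+
  qed
  define a k where "a = sqrt \<sigma>" and "k = sqrt (1 - \<sigma>)"
  have ak: "a * a = \<sigma>" "k * k = 1 - \<sigma>" "a\<^sup>2 = \<sigma>" "k\<^sup>2 = 1 - \<sigma>" "a \<ge> 0" "k \<ge> 0"
    using \<sigma> by (simp_all add: a_def k_def)
  define f where "f = a *\<^sub>R e 0 + k *\<^sub>R e 1"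
  have ff: "cinner f f = 1"
  proof -
    have "cinner f f = of_real (a * a + k * k)"
      by (simp add: f_def cinner_add_left cinner_add_right cinner_scaleR_left cinner_scaleR_right ee del: ak)
    then show ?thesis
      by (simp add: ak)
  qed
  define q2 qf where "q2 = rank1 (e 1) (e 1)" and "qf = rank1 f f"
  note q2 = selfadjoint_on_rank1[OF ee(2), folded q2_def]
  note qf = selfadjoint_on_rank1[OF ff, folded qf_def]
  define A B where "A = s *\<^sub>R (id_blinfun - q2) + r *\<^sub>R q2"
    and "B = (s - 1) *\<^sub>R (id_blinfun - qf) + t *\<^sub>R qf"
  have mem: "s \<in> {s - 1..r}" "r \<in> {s - 1..r}" "s - 1 \<in> {s - 1..r}" "t \<in> {s - 1..r}"
    using \<open>s < t\<close> r by auto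
  note g = SOC_continuous_on[OF soc r(2), of "s - 1"]
  note A = cfc_on_two_values[OF q2 mem(1,2) g, folded A_def]
  note B = cfc_on_two_values[OF qf mem(3,4) g, folded B_def]
  have le: "inner (B x) x \<le> inner (A x) x" for x
  proof -
    define X Y Z where "X = cmod (cinner x (e 0))" and "Y = cmod (cinner x (e 1))"
      and "Z = cmod (cinner x f)"
    have "X\<^sup>2 + Y\<^sup>2 \<le> (norm x)\<^sup>2"
      unfolding X_def Y_def by (rule norm_cinner_orthonormal_pair_le[OF e])
    have "Z \<le> a * X + k * Y"
      unfolding Z_def X_def Y_def f_def cinner_add_right cinner_scaleR_right
      using norm_triangle_ineq[of "of_real a * cinner x (e 0)" "of_real k * cinner x (e 1)"] ak
      by (simp add: norm_mult)
    then have "Z\<^sup>2 \<le> (a * X + k * Y)\<^sup>2"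
      by (intro power_mono) (simp_all add: Z_def)
    also have "\<dots> \<le> (\<sigma> + (1 - \<sigma>) / v) * (X\<^sup>2 + v * Y\<^sup>2)"
      using weighted_Cauchy_Schwarz[of v a X k Y] uv by (simp add: ak)
    also have "\<dots> \<le> (1 / u) * (X\<^sup>2 + v * Y\<^sup>2)"
    proof (rule mult_right_mono)
      have "\<sigma> + (1 - \<sigma>) / v = \<sigma> * (1 - 1 / v) + 1 / v"
        by (simp add: diff_divide_distrib algebra_simps)
      also have "\<dots> \<le> \<sigma> * 1 + 1 / v"
        using \<sigma>(1) uv by (intro add_mono mult_left_mono) simp_all
      also have "\<dots> = 1 / u"
        by (simp add: \<sigma>_def)
      finally show "\<sigma> + (1 - \<sigma>) / v \<le> 1 / u" .
    qed (use uv in simp)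
    finally have "u * Z\<^sup>2 \<le> X\<^sup>2 + v * Y\<^sup>2"
      using uv by (simp add: field_simps)
    also have "\<dots> \<le> (norm x)\<^sup>2 + (v - 1) * Y\<^sup>2"
      using \<open>X\<^sup>2 + Y\<^sup>2 \<le> (norm x)\<^sup>2\<close> by (simp add: algebra_simps)
    finally have "u * Z\<^sup>2 \<le> (norm x)\<^sup>2 + (v - 1) * Y\<^sup>2" .
    moreover have "inner (A x) x = s * (norm x)\<^sup>2 + (v - 1) * Y\<^sup>2"
      by (simp add: A_def q2_def blinfun.add_left blinfun.scaleR_left blinfun.diff_left inner_add_left
          inner_diff_left inner_rank1_self dot_square_norm Y_def v_def algebra_simps)
    moreover have "inner (B x) x = (s - 1) * (norm x)\<^sup>2 + u * Z\<^sup>2"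
      by (simp add: B_def qf_def blinfun.add_left blinfun.scaleR_left blinfun.diff_left inner_add_left
          inner_diff_left inner_rank1_self dot_square_norm Z_def u_def algebra_simps)
    ultimately show ?thesis
      by (simp add: algebra_simps)
  qed
  have "inner (cfc g B (e 0)) (e 0) \<le> inner (cfc g A (e 0)) (e 0)"
    using A(1) B(1) unfolding selfadjoint_on_id
    by (intro SOC_operator_monotone[OF infinite_dim soc _ A(2) _ B(2) r(2) le])
  moreover have "inner (cfc g A (e 0)) (e 0) = g s"
  proof -
    have "inner (q2 (e 0)) (e 0) = 0"
      using ee by (simp add: q2_def inner_rank1_self)
    moreover have "inner (e 0) (e 0) = 1"
      using ee by (simp add: Re_cinner[symmetric])
    ultimately show ?thesis
      unfolding A(3)
      by (simp add: blinfun.add_left blinfun.scaleR_left blinfun.diff_left inner_add_left inner_diff_left)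
  qed
  moreover have "inner (cfc g B (e 0)) (e 0) = g s * (1 - \<sigma>) + g t * \<sigma>"
  proof -
    have "cinner (e 0) f = of_real a"
      by (simp add: f_def cinner_add_right cinner_scaleR_right ee)
    then have "inner (qf (e 0)) (e 0) = \<sigma>"
      by (simp add: qf_def inner_rank1_self ak)
    moreover have "inner (e 0) (e 0) = 1"
      using ee by (simp add: Re_cinner[symmetric])
    ultimately show ?thesis
      unfolding B(3) eq
      by (simp add: blinfun.add_left blinfun.scaleR_left blinfun.diff_left inner_add_left inner_diff_left)
  qed
  ultimately have "\<sigma> * g t \<le> \<sigma> * g s"
    by (simp add: algebra_simps)
  then show "g t \<le> g s"
    using \<sigma>(1) by simp
qed

text \<open>
  A monotone convex function that takes the same value at two points is constant to the left of them, and
  then the preceding lemma forbids any later increase.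
\<close>

lemma SOC_strict_mono_on:
  assumes infinite_dim: "\<not> (\<exists>S :: 'u::complex_hilbert set. finite S \<and> span S = UNIV)"
    and soc: "g \<in> SOC TYPE('u) {..<b}" and nonconst: "\<not> g constant_on {..<b}"
  shows "strict_mono_on {..<b} g"
proof (rule strict_mono_onI)
  note mono = mono_onD[OF SOC_mono_on[OF infinite_dim soc]]
  note convex = convex_onD[OF SOC_convex_on[OF infinite_dim soc]]
  fix s0 s assume s: "s0 \<in> {..<b}" "s \<in> {..<b}" "s0 < s"
  show "g s0 < g s"
  proof (rule ccontr)
    assume "\<not> g s0 < g s"
    then have eq: "g s0 = g s"
      using mono[of s0 s] s by simp
    have left: "g t = g s" if "t \<le> s" for t
    proof (cases "s0 \<le> t")
      case True
      then show ?thesis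
        using mono[of s0 t] mono[of t s] s that eq by simp
    next
      case False
      define l where "l = (s0 - t) / (s - t)"
      have l: "0 < l" "l < 1" "l * (s - t) = s0 - t"
        using False s by (simp_all add: l_def)
      have pt: "(1 - l) *\<^sub>R t + l *\<^sub>R s = s0"
        using l(3) by (simp add: algebra_simps)
      have "g s0 \<le> (1 - l) * g t + l * g s"
        using convex[of l t s] l(1,2) s that unfolding pt by auto
      then have "(1 - l) * g s \<le> (1 - l) * g t"
        by (simp add: eq algebra_simps)
      then have "g s \<le> g t"
        using l(2) by simp
      then show ?thesis
        using mono[of t s] s that by simp
    qed
    have "g t = g s" if "t < b" for t
    proof (cases "t \<le> s")
      case True
      then show ?thesis
        by (rule left)
    next
      case False
      then have "g t \<le> g s"
        using SOC_le_after_plateau[OF infinite_dim soc, of s t] left[of "s - 1"] that by simp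
      then show ?thesis
        using mono[of s t] False s that by simp
    qed
    then show False
      using nonconst unfolding constant_on_def by auto
  qed
qed

section \<open>Operators with a spectral gap\<close>

lemma id_blinfun_nonzero:
  assumes "(UNIV :: 'h::real_normed_vector set) \<noteq> {0}"
  shows "(id_blinfun :: 'h \<Rightarrow>\<^sub>L 'h) \<noteq> 0"
  using assms by (metis UNIV_eq_I blinfun_apply_id_blinfun insertCI singletonD zero_blinfun.rep_eq)

text \<open>
  The smallest spectral value of a positive invertible operator is nonnegative and different from zero.
\<close>

lemma op_less_gap:
  fixes S :: "'h::complex_hilbert \<Rightarrow>\<^sub>L 'h"
  assumes nz: "(UNIV :: 'h set) \<noteq> {0}"
    and S: "selfadjoint S" "positive_op S" "invertible_op S"
  obtains m where "m > 0" "\<And>x. m * (norm x)\<^sup>2 \<le> inner (S x) x"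
proof -
  note id = id_blinfun_nonzero[OF nz]
  have sa: "selfadjoint_on id_blinfun S"
    using S(1) by (simp add: selfadjoint_on_id)
  obtain m hi where m: "form_between id_blinfun S m hi" "complex_of_real m \<in> spectrum S"
    using spectrum_on_extreme[OF sa id] by blast
  have "form_between id_blinfun S 0 (norm S)"
    using form_between_norm[OF sa] positive_opD[OF S(2)] by (simp add: form_between_def)
  then have "0 \<le> m"
    using spectrum_on_between(1)[OF sa _ m(2)] by blast
  moreover have "m \<noteq> 0"
    using m(2) S(3) by (auto simp: spectrum_on_def scalar_op_of_real[of 0, simplified])
  ultimately show ?thesis
    using that[of m] m(1) by (simp add: form_between_def)
qed

lemma min_sp_eq:
  assumes "selfadjoint T" "form_between id_blinfun T lo hi" "complex_of_real lo \<in> spectrum T"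
  shows "min_sp T = lo"
  unfolding min_sp_def using assms
  by (intro Least_equality) (auto dest: spectrum_on_between(1) simp: selfadjoint_on_id[symmetric])

lemma selfadjoint_spectrum_bounds:
  fixes T :: "'h::complex_hilbert \<Rightarrow>\<^sub>L 'h"
  assumes nz: "(UNIV :: 'h set) \<noteq> {0}"
    and T: "selfadjoint T" "spectrum T \<subseteq> complex_of_real ` {..<b}"
  obtains hi where "form_between id_blinfun T (min_sp T) hi" "hi < b" "min_sp T \<le> hi"
proof -
  note id = id_blinfun_nonzero[OF nz]
  have sa: "selfadjoint_on id_blinfun T"
    using T(1) by (simp add: selfadjoint_on_id)
  obtain lo hi where m: "form_between id_blinfun T lo hi" "complex_of_real lo \<in> spectrum T"
      "complex_of_real hi \<in> spectrum T"
    using spectrum_on_extreme[OF sa id] .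
  have "hi < b"
    using m(3) T(2) by auto
  moreover have "lo \<le> hi"
    by (rule spectrum_on_between(1)[OF sa m(1,3)])
  ultimately show ?thesis
    using that m(1) min_sp_eq[OF T(1) m(1,2)] by simp
qed

text \<open>
  As \<open>B \<le> A - m\<close>, operator monotonicity gives \<open>g(A) - g(B) \<ge> g(A) - g(A - m) = \<phi>(A)\<close> with
  \<open>\<phi> t = g t - g (t - m)\<close>. This function is nondecreasing because \<open>g\<close> is convex, so \<open>\<phi>(A)\<close> is bounded below by
  the value of \<open>\<phi>\<close> at the least point of the spectrum of \<open>A\<close>, and that point is at least \<open>min_sp B + m\<close>.
\<close>

lemma SOC_gap:
  fixes A B :: "'h::complex_hilbert \<Rightarrow>\<^sub>L 'h"
  assumes infinite_dim: "\<not> (\<exists>S :: 'u::complex_hilbert set. finite S \<and> span S = UNIV)"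
    and nz: "(UNIV :: 'h set) \<noteq> {0}"
    and soc: "g \<in> SOC TYPE('u) {..<b}" and nonconst: "\<not> g constant_on {..<b}"
    and A: "selfadjoint A" "spectrum A \<subseteq> complex_of_real ` {..<b}"
    and B: "selfadjoint B" "spectrum B \<subseteq> complex_of_real ` {..<b}"
    and "m > 0" and gap: "\<And>x. m * (norm x)\<^sup>2 \<le> inner ((A - B) x) x"
  shows "selfadjoint (cfc g A - cfc g B)"
    "(g (min_sp A) - g (min_sp A - m)) * (norm x)\<^sup>2 \<le> inner ((cfc g A - cfc g B) x) x"
    "g (min_sp B + m) - g (min_sp B) \<le> g (min_sp A) - g (min_sp A - m)"
    "0 < g (min_sp B + m) - g (min_sp B)"
proof -
  note strict = strict_mono_onD[OF SOC_strict_mono_on[OF infinite_dim soc nonconst]]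
  note mono = mono_onD[OF SOC_mono_on[OF infinite_dim soc]]
  obtain \<alpha> where \<alpha>: "form_between id_blinfun A (min_sp A) \<alpha>" "\<alpha> < b" "min_sp A \<le> \<alpha>"
    using selfadjoint_spectrum_bounds[OF nz A] .
  obtain \<beta> where \<beta>: "form_between id_blinfun B (min_sp B) \<beta>" "\<beta> < b" "min_sp B \<le> \<beta>"
    using selfadjoint_spectrum_bounds[OF nz B] .
  note A_sa = A(1)[folded selfadjoint_on_id] and B_sa = B(1)[folded selfadjoint_on_id]
  define \<tau> where "\<tau> = min_sp A"
  define \<phi> where "\<phi> t = g t - g (t - m)" for t
  \<comment> \<open>The points s and t - m are convex combinations of s - m and t with exchanged weights; add the two
    convexity inequalities.\<close>
  have \<phi>_mono: "\<phi> s \<le> \<phi> t" if "s \<le> t" "t < b" for s t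
  proof (cases "s = t")
    case False
    define l where "l = m / (t - s + m)"
    have d: "t - s + m > 0"
      using that \<open>m > 0\<close> by simp
    then have l: "0 \<le> l" "l \<le> 1" "l * (t - s + m) = m"
      using that \<open>m > 0\<close> by (simp_all add: l_def)
    have pts: "(1 - l) *\<^sub>R (s - m) + l *\<^sub>R t = s" "(1 - l) *\<^sub>R t + l *\<^sub>R (s - m) = t - m"
      using l(3) by (simp_all add: algebra_simps)
    note convex = convex_onD[OF SOC_convex_on[OF infinite_dim soc] l(1,2)]
    have "g s \<le> (1 - l) * g (s - m) + l * g t" "g (t - m) \<le> (1 - l) * g t + l * g (s - m)"
      using convex[of "s - m" t] convex[of t "s - m"] that \<open>m > 0\<close> unfolding pts by simp_all
    then show ?thesis
      by (simp add: \<phi>_def algebra_simps)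
  qed simp
  have le: "(min_sp B + m) \<le> \<tau>"
  proof -
    have "form_between id_blinfun A (min_sp B + m) \<alpha>"
      unfolding form_between_def
    proof
      fix x
      have "min_sp B * (norm x)\<^sup>2 \<le> inner (B x) x"
        using \<beta>(1) by (simp add: form_between_def)
      then show "(min_sp B + m) * (norm (id_blinfun x))\<^sup>2 \<le> inner (A x) x \<and>
          inner (A x) x \<le> \<alpha> * (norm (id_blinfun x))\<^sup>2"
        using gap[of x] \<alpha>(1)
        by (simp add: form_between_def blinfun.diff_left inner_diff_left algebra_simps)
    qed
    moreover have "complex_of_real \<tau> \<in> spectrum A"
      using spectrum_on_extreme[OF A_sa id_blinfun_nonzero[OF nz]] min_sp_eq[OF A(1)]
      unfolding \<tau>_def by metis
    ultimately show ?thesis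
      by (rule spectrum_on_between(1)[OF A_sa])
  qed
  have "\<tau> < b"
    using \<alpha> by (simp add: \<tau>_def)
  show "0 < g (min_sp B + m) - g (min_sp B)"
    using strict[of "min_sp B" "min_sp B + m"] le \<open>\<tau> < b\<close> \<open>m > 0\<close> by simp
  show "g (min_sp B + m) - g (min_sp B) \<le> g (min_sp A) - g (min_sp A - m)"
    using \<phi>_mono[OF le \<open>\<tau> < b\<close>] by (simp add: \<phi>_def \<tau>_def)
  define A' where "A' = A - m *\<^sub>R id_blinfun"
  have A'_sa: "selfadjoint A'"
    using A(1) unfolding A'_def selfadjoint_iff by (intro is_adjoint_intros)
  define lo hi where "lo = min (min_sp B) (\<tau> - m)" and "hi = max \<alpha> \<beta>"
  have "hi < b"
    using \<alpha> \<beta> by (simp add: hi_def)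
  have widen: "form_between id_blinfun T lo hi"
    if "form_between id_blinfun T l h" "lo \<le> l" "h \<le> hi" for T :: "'h \<Rightarrow>\<^sub>L 'h" and l h
    using that unfolding form_between_def by (meson mult_right_mono order_trans zero_le_power2)
  have A_bet: "form_between id_blinfun A lo hi" and B_bet: "form_between id_blinfun B lo hi"
    by (rule widen[OF \<alpha>(1)] widen[OF \<beta>(1)]; use \<open>m > 0\<close> in \<open>simp add: lo_def hi_def \<tau>_def min_le_iff_disj\<close>)+
  have "form_between id_blinfun A' (\<tau> - m) (\<alpha> - m)"
    using \<alpha>(1) by (simp add: form_between_def A'_def \<tau>_def blinfun.diff_left blinfun.scaleR_left
        inner_diff_left dot_square_norm left_diff_distrib)
  then have A'_bet: "form_between id_blinfun A' lo hi"
    by (rule widen) (use \<open>m > 0\<close> in \<open>simp_all add: lo_def hi_def\<close>)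
  note g = SOC_continuous_on[OF soc]
  have gA: "continuous_on {\<tau>..\<alpha>} g" "continuous_on {\<tau> - m..\<alpha> - m} g"
    using \<alpha>(2) \<open>m > 0\<close> by (intro g; simp)+
  then have gAm: "continuous_on {\<tau>..\<alpha>} (\<lambda>t. g (t - m))"
    by (intro continuous_on_compose2[OF gA(2)] continuous_intros) auto
  note A_\<tau> = \<alpha>(1)[folded \<tau>_def]
  have "cfc \<phi> A = cfc g A - cfc g A'"
    unfolding \<phi>_def A'_def cfc_on_diff[OF A_sa A_\<tau> gA(1) gAm] cfc_on_shift[OF A_sa A_\<tau> gA(2)] ..
  moreover have "form_between id_blinfun (cfc \<phi> A) (\<phi> \<tau>) (\<phi> \<alpha>)"
  proof (rule form_between_cfc[OF A_sa A_\<tau>])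
    show "continuous_on {\<tau>..\<alpha>} \<phi>"
      unfolding \<phi>_def by (intro continuous_intros gA gAm)
  qed (use \<phi>_mono \<alpha> in \<open>auto simp: \<tau>_def\<close>)
  ultimately have "\<phi> \<tau> * (norm x)\<^sup>2 \<le> inner (cfc g A x) x - inner (cfc g A' x) x"
    by (simp add: form_between_def blinfun.diff_left inner_diff_left)
  moreover have "inner (B y) y \<le> inner (A' y) y" for y
    using gap[of y] by (simp add: A'_def blinfun.diff_left blinfun.scaleR_left inner_diff_left dot_square_norm)
  then have "inner (cfc g B x) x \<le> inner (cfc g A' x) x"
    by (rule SOC_operator_monotone[OF infinite_dim soc A'_sa A'_bet B(1) B_bet \<open>hi < b\<close>])
  ultimately show "(g (min_sp A) - g (min_sp A - m)) * (norm x)\<^sup>2 \<le> inner ((cfc g A - cfc g B) x) x"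
    by (simp add: \<phi>_def \<tau>_def blinfun.diff_left inner_diff_left)
  show "selfadjoint (cfc g A - cfc g B)"
    using selfadjoint_on_diff[OF selfadjoint_on_cfc[OF A_sa A_bet g] selfadjoint_on_cfc[OF B_sa B_bet g]]
      \<open>hi < b\<close> by (simp add: selfadjoint_on_id)
qed

text \<open>
  For the strict inequality in the first part, \<open>A > B\<close> yields a gap \<open>A - B \<ge> m > 0\<close>, so that the second part
  bounds \<open>g(A) - g(B)\<close> below by a positive scalar.
\<close>

theorem theorem3p8:
  fixes b :: real and g :: "real \<Rightarrow> real"
    and A B :: "'h::complex_hilbert \<Rightarrow>\<^sub>L 'h"
  assumes infinite_dim: "\<not> (\<exists>S :: 'u::complex_hilbert set. finite S \<and> span S = UNIV)"
    and nonzero_space: "(UNIV :: 'h set) \<noteq> {0}"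
    and soc: "g \<in> SOC TYPE('u) {..<b}"
    and nonzero: "\<exists>t<b. g t \<noteq> 0"
    and nonconst: "\<not> g constant_on {..<b}"
    and A: "selfadjoint A" "spectrum A \<subseteq> complex_of_real ` {..<b}"
    and B: "selfadjoint B" "spectrum B \<subseteq> complex_of_real ` {..<b}"
  shows "(op_less B A \<longrightarrow> op_less (cfc g B) (cfc g A)) \<and>
    (\<forall>m>0. op_le (m *\<^sub>R id_blinfun) (A - B) \<longrightarrow>
       op_le ((g (min_sp A) - g (min_sp A - m)) *\<^sub>R id_blinfun) (cfc g A - cfc g B) \<and>
       g (min_sp A) - g (min_sp A - m) \<ge> g (min_sp B + m) - g (min_sp B) \<and>
       g (min_sp B + m) - g (min_sp B) > 0)"
proof (intro conjI[of "_ \<longrightarrow> _"] impI allI)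
  note main = SOC_gap[OF infinite_dim nonzero_space soc nonconst A B]
  have AB: "selfadjoint (A - B)"
    using A(1) B(1) unfolding selfadjoint_iff by (rule is_adjoint_diff)
  {
    assume "op_less B A"
    then obtain m where m: "m > 0" "\<And>x. m * (norm x)\<^sup>2 \<le> inner ((A - B) x) x"
      using op_less_gap[OF nonzero_space AB] unfolding op_less_def by blast
    note gap = main[OF m]
    define \<delta> where "\<delta> = g (min_sp A) - g (min_sp A - m)"
    have "\<delta> > 0"
      using gap(3,4) by (simp add: \<delta>_def)
    have "0 \<le> inner ((cfc g A - cfc g B) x) x" for x
      using order_trans[OF _ gap(2)[of x, folded \<delta>_def]] \<open>\<delta> > 0\<close> by simp
    moreover have "invertible_op (cfc g A - cfc g B)"
      using gap(1,2) \<open>\<delta> > 0\<close>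
      by (intro coercive_invertible_on[where \<delta> = \<delta>]) (simp_all add: selfadjoint_on_id \<delta>_def)
    ultimately show "op_less (cfc g B) (cfc g A)"
      using positive_op_iff[OF gap(1)] by (simp add: op_less_def)
  }
  {
    fix m :: real assume m: "m > 0" and "op_le (m *\<^sub>R id_blinfun) (A - B)"
    then have "m * (norm x)\<^sup>2 \<le> inner ((A - B) x) x" for x
      using op_leD[of "m *\<^sub>R id_blinfun" "A - B" x] by (simp add: blinfun.scaleR_left dot_square_norm)
    note gap = main[OF m this]
    define \<delta> where "\<delta> = g (min_sp A) - g (min_sp A - m)"
    have "selfadjoint (cfc g A - cfc g B - \<delta> *\<^sub>R id_blinfun)"
      using is_adjoint_diff[OF gap(1)[unfolded selfadjoint_iff] is_adjoint_scaleR[OF is_adjoint_id]]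
      by (simp add: selfadjoint_iff)
    then have "op_le (\<delta> *\<^sub>R id_blinfun) (cfc g A - cfc g B)"
      using gap(2) unfolding op_le_def
      by (subst positive_op_iff) (simp_all add: blinfun.diff_left blinfun.scaleR_left inner_diff_left dot_square_norm \<delta>_def)
    then show "op_le ((g (min_sp A) - g (min_sp A - m)) *\<^sub>R id_blinfun) (cfc g A - cfc g B) \<and>
       g (min_sp A) - g (min_sp A - m) \<ge> g (min_sp B + m) - g (min_sp B) \<and>
       g (min_sp B + m) - g (min_sp B) > 0"
      using gap(3,4) by (simp add: \<delta>_def)
  }
qed

end
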